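(* Let $X$ be a normal regular topological space, let $n\in\mathbb N$, and let $A=C^b(X,M_n)$, the C*-algebra of bounded continuous functions from $X$ to the $n\times n$ complex matrices $M_n$, represented on $\bigoplus_{x\in X}\mathbb C^n$ by $f(v_x)_{x\in X}=(f(x)v_x)_{x\in X}$, so that $A''$ is identified with a subset of the algebra $B(X,M_n)$ of bounded functions from $X$ to $M_n$. Then $$C^\circ(X,\mathcal P(M_n))=\mathcal P(A'')^\circ\qquad\text{and}\qquad\overline C(X,\mathcal P(M_n))=\overline{\mathcal P(A'')},$$ i.e. the open (respectively closed) projections for $A$ are precisely the lower (respectively upper) semicontinuous functions from $X$ to the projections of $M_n$.
   Context: $\mathcal P(M_n)$ is the set of projections in $M_n$. A function $p:X\to\mathcal P(M_n)$ is lower semicontinuous if for every $x\in X$ and every $\epsilon>0$ there is a neighbourhood $Y$ of $x$ such that $\|p(y)^\perp p(x)\|<\epsilon$ for all $y\in Y$, where $p(y)^\perp=1-p(y)$; it is upper semicontinuous if $x\mapsto p(x)^\perp$ is lower semicontinuous. $C^\circ(X,\mathcal P(M_n))$ and $\overline C(X,\mathcal P(M_n))$ denote the sets of lower and upper semicontinuous functions $X\to\mathcal P(M_n)$ respectively. For a C*-algebra $A$ represented faithfully and non-degenerately on a Hilbert space $H$, a projection $p\in\mathcal B(H)$ is open if $p=\sup_\alpha a_\alpha$ for some increasing net $(a_\alpha)$ of positive elements of $A$ of norm at most $1$, and closed if $1-p$ is open; such projections lie in the double commutant $A''$. $\mathcal P(A'')^\circ$ and $\overline{\mathcal P(A'')}$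 denote the sets of open and closed projections respectively. *)

theory Defs
  imports "HOL-Analysis.Analysis"
begin

section \<open>Complex Hilbert spaces and open projections\<close>

text \<open>The inner product is conjugate linear in its first argument, and its real part
  is the real inner product of the type.\<close>

class complex_hilbert = real_inner + complete_space +
  fixes scaleC :: "complex \<Rightarrow> 'a \<Rightarrow> 'a" (infixr \<open>*\<^sub>C\<close> 75)
    and cinner :: "'a \<Rightarrow> 'a \<Rightarrow> complex"
  assumes scaleC_add_right: "c *\<^sub>C (u + v) = c *\<^sub>C u + c *\<^sub>C v"
    and scaleC_add_left: "(c + d) *\<^sub>C v = c *\<^sub>C v + d *\<^sub>C v"
    and scaleC_scaleC: "c *\<^sub>C d *\<^sub>C v = (c * d) *\<^sub>C v"
    and scaleC_of_real: "complex_of_real r *\<^sub>C v = r *\<^sub>R v"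
    and cinner_commute: "cinner u v = cnj (cinner v u)"
    and cinner_add_right: "cinner u (v + w) = cinner u v + cinner u w"
    and cinner_scaleC_right: "cinner u (c *\<^sub>C v) = c * cinner u v"
    and Re_cinner: "Re (cinner u v) = inner u v"

text \<open>Bounded operators are real bounded linear maps \<^typ>\<open>'h \<Rightarrow>\<^sub>L 'h\<close> that are complex linear;
  their norm there is the usual operator norm.\<close>

definition bounded_ops :: "('h::complex_hilbert \<Rightarrow>\<^sub>L 'h) set" where
  "bounded_ops = {T. \<forall>c v. blinfun_apply T (c *\<^sub>C v) = c *\<^sub>C blinfun_apply T v}"

definition selfadjoint :: "('h::complex_hilbert \<Rightarrow>\<^sub>L 'h) \<Rightarrow> bool" where
  "selfadjoint T \<longleftrightarrow> T \<in> bounded_ops \<and>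
     (\<forall>u v. cinner (blinfun_apply T u) v = cinner u (blinfun_apply T v))"

definition positive_op :: "('h::complex_hilbert \<Rightarrow>\<^sub>L 'h) \<Rightarrow> bool" where
  "positive_op T \<longleftrightarrow> selfadjoint T \<and> (\<forall>v. 0 \<le> Re (cinner v (blinfun_apply T v)))"

definition op_le :: "('h::complex_hilbert \<Rightarrow>\<^sub>L 'h) \<Rightarrow> ('h \<Rightarrow>\<^sub>L 'h) \<Rightarrow> bool" where
  "op_le S T \<longleftrightarrow> positive_op (T - S)"

definition projection_op :: "('h::complex_hilbert \<Rightarrow>\<^sub>L 'h) \<Rightarrow> bool" where
  "projection_op p \<longleftrightarrow> selfadjoint p \<and> p o\<^sub>L p = p"

definition is_op_sup :: "('h::complex_hilbert \<Rightarrow>\<^sub>L 'h) set \<Rightarrow> ('h \<Rightarrow>\<^sub>L 'h) \<Rightarrow> bool" where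
  "is_op_sup D s \<longleftrightarrow> selfadjoint s \<and> (\<forall>a\<in>D. op_le a s) \<and>
     (\<forall>t. selfadjoint t \<longrightarrow> (\<forall>a\<in>D. op_le a t) \<longrightarrow> op_le s t)"

definition directed_preorder :: "'i set \<Rightarrow> ('i \<Rightarrow> 'i \<Rightarrow> bool) \<Rightarrow> bool" where
  "directed_preorder I le \<longleftrightarrow> I \<noteq> {} \<and> (\<forall>i\<in>I. le i i) \<and>
     (\<forall>i\<in>I. \<forall>j\<in>I. \<forall>k\<in>I. le i j \<longrightarrow> le j k \<longrightarrow> le i k) \<and>
     (\<forall>i\<in>I. \<forall>j\<in>I. \<exists>k\<in>I. le i k \<and> le j k)"

definition increasing_net ::
    "'i set \<Rightarrow> ('i \<Rightarrow> 'i \<Rightarrow> bool) \<Rightarrow> ('i \<Rightarrow> ('h::complex_hilbert \<Rightarrow>\<^sub>L 'h)) \<Rightarrow> bool" where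
  "increasing_net I le a \<longleftrightarrow> directed_preorder I le \<and>
     (\<forall>i\<in>I. \<forall>j\<in>I. le i j \<longrightarrow> op_le (a i) (a j))"

text \<open>The index sets range over sets of operators. This loses no nets: the range of an
  increasing net is directed by \<^const>\<open>op_le\<close>, and so is itself the index set of an increasing
  net with the same supremum.\<close>

definition open_projections :: "('h::complex_hilbert \<Rightarrow>\<^sub>L 'h) set \<Rightarrow> ('h \<Rightarrow>\<^sub>L 'h) set" where
  "open_projections A = {p. projection_op p \<and>
     (\<exists>(I :: ('h \<Rightarrow>\<^sub>L 'h) set) le a. increasing_net I le a \<and>
        (\<forall>i\<in>I. a i \<in> A \<and> positive_op (a i) \<and> norm (a i) \<le> 1) \<and>
        is_op_sup (a ` I) p)}"

definition closed_projections :: "('h::complex_hilbert \<Rightarrow>\<^sub>L 'h) set \<Rightarrow> ('h \<Rightarrow>\<^sub>L 'h) set" where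
  "closed_projections A = {p. projection_op p \<and> id_blinfun - p \<in> open_projections A}"


section \<open>Semicontinuous projection-valued functions\<close>

definition ctranspose :: "complex^'n^'n \<Rightarrow> complex^'n^'n" where
  "ctranspose M = (\<chi> i j. cnj (M $ j $ i))"

definition projection_matrices :: "(complex^'n^'n) set" where
  "projection_matrices = {P. ctranspose P = P \<and> P ** P = P}"

text \<open>The C*-norm on matrices; the type class \<^const>\<open>norm\<close> on matrices is the Frobenius norm.\<close>

definition matrix_opnorm :: "complex^'n^'n \<Rightarrow> real" where
  "matrix_opnorm M = onorm (\<lambda>v. M *v v)"

definition lower_semicontinuous :: "('x::topological_space \<Rightarrow> complex^'n^'n) \<Rightarrow> bool" where
  "lower_semicontinuous p \<longleftrightarrow>
     (\<forall>x. \<forall>\<epsilon>>0. \<forall>\<^sub>F y in nhds x. matrix_opnorm ((mat 1 - p y) ** p x) < \<epsilon>)"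

definition upper_semicontinuous :: "('x::topological_space \<Rightarrow> complex^'n^'n) \<Rightarrow> bool" where
  "upper_semicontinuous p \<longleftrightarrow> lower_semicontinuous (\<lambda>x. mat 1 - p x)"

definition lsc_projections :: "('x::topological_space \<Rightarrow> complex^'n^'n) set" where
  "lsc_projections = {p. range p \<subseteq> projection_matrices \<and> lower_semicontinuous p}"

definition usc_projections :: "('x::topological_space \<Rightarrow> complex^'n^'n) set" where
  "usc_projections = {p. range p \<subseteq> projection_matrices \<and> upper_semicontinuous p}"


section \<open>The Hilbert space direct sum\<close>

typedef ('x, 'n::finite) l2_sum =
  "{v :: 'x \<Rightarrow> complex^'n. (\<lambda>x. (norm (v x))\<^sup>2) summable_on UNIV}"
  morphisms l2_fun Abs_l2
  by (intro exI[of _ "\<lambda>_. 0"]) simp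

setup_lifting type_definition_l2_sum

definition cdot :: "complex^'n \<Rightarrow> complex^'n \<Rightarrow> complex" where
  "cdot u v = (\<Sum>i\<in>UNIV. cnj (u $ i) * v $ i)"

lemma Re_cdot: "Re (cdot u v) = inner u v"
  unfolding cdot_def inner_vec_def by (simp add: inner_complex_def Re_sum)

lemma cdot_commute: "cdot u v = cnj (cdot v u)"
  unfolding cdot_def by (simp add: cnj_sum mult.commute)

lemma cdot_add_right: "cdot u (v + w) = cdot u v + cdot u w"
  unfolding cdot_def by (simp add: algebra_simps sum.distrib)

lemma cdot_scale_right: "cdot u (c *s v) = c * cdot u v"
  unfolding cdot_def by (simp add: algebra_simps sum_distrib_left)

lemma norm_scale_vec: "norm (c *s v) = cmod c * norm (v :: complex^'n)"
  unfolding norm_vec_def L2_set_def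
  by (simp add: norm_mult power_mult_distrib sum_distrib_left[symmetric] real_sqrt_mult)

lemma norm_cdot_le: "cmod (cdot u v) \<le> norm u * norm v"
proof -
  have "cmod (cdot u v) \<le> (\<Sum>i\<in>UNIV. \<bar>cmod (u $ i)\<bar> * \<bar>cmod (v $ i)\<bar>)"
    unfolding cdot_def by (rule order_trans[OF norm_sum]) (simp add: norm_mult)
  also have "\<dots> \<le> norm u * norm v"
    unfolding norm_vec_def by (rule L2_set_mult_ineq)
  finally show ?thesis .
qed

lemma two_mult_le_squares: "a * b \<le> a\<^sup>2 + (b::real)\<^sup>2"
proof -
  have "0 \<le> (a - b)\<^sup>2" "0 \<le> a\<^sup>2" "0 \<le> b\<^sup>2" by simp_all
  then show ?thesis unfolding power2_diff by linarith
qed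

lemma l2_add:
  fixes u v :: "'x \<Rightarrow> 'b::real_normed_vector"
  assumes "(\<lambda>x. (norm (u x))\<^sup>2) summable_on UNIV" "(\<lambda>x. (norm (v x))\<^sup>2) summable_on UNIV"
  shows "(\<lambda>x. (norm (u x + v x))\<^sup>2) summable_on UNIV"
proof (rule summable_on_comparison_test)
  show "(\<lambda>x. 2 * (norm (u x))\<^sup>2 + 2 * (norm (v x))\<^sup>2) summable_on UNIV"
    by (intro summable_on_add summable_on_cmult_right assms)
  fix x
  have "(norm (u x + v x))\<^sup>2 \<le> (norm (u x) + norm (v x))\<^sup>2"
    by (intro power_mono norm_triangle_ineq) simp
  also have "\<dots> \<le> 2 * (norm (u x))\<^sup>2 + 2 * (norm (v x))\<^sup>2"
    using zero_le_power2[of "norm (u x) - norm (v x)"] unfolding power2_diff power2_sum by linarith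
  finally show "(norm (u x + v x))\<^sup>2 \<le> 2 * (norm (u x))\<^sup>2 + 2 * (norm (v x))\<^sup>2" .
qed simp

lemma l2_bound:
  assumes "(\<lambda>x. (norm (v x))\<^sup>2) summable_on UNIV" "\<And>x. norm (w x) \<le> K * norm (v x)"
  shows "(\<lambda>x. (norm (w x))\<^sup>2) summable_on UNIV"
proof (rule summable_on_comparison_test)
  show "(\<lambda>x. K\<^sup>2 * (norm (v x))\<^sup>2) summable_on UNIV"
    by (intro summable_on_cmult_right assms)
  fix x
  have "(norm (w x))\<^sup>2 \<le> (K * norm (v x))\<^sup>2"
    by (intro power_mono assms) simp
  then show "(norm (w x))\<^sup>2 \<le> K\<^sup>2 * (norm (v x))\<^sup>2" by (simp add: power_mult_distrib)
qed simp

lemma l2_cdot_summable: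
  assumes "(\<lambda>x. (norm (u x))\<^sup>2) summable_on UNIV" "(\<lambda>x. (norm (v x))\<^sup>2) summable_on UNIV"
  shows "(\<lambda>x. cdot (u x) (v x)) summable_on UNIV"
proof -
  have "(\<lambda>x. cmod (cdot (u x) (v x))) summable_on UNIV"
  proof (rule summable_on_comparison_test)
    show "(\<lambda>x. (norm (u x))\<^sup>2 + (norm (v x))\<^sup>2) summable_on UNIV"
      by (intro summable_on_add assms)
    show "cmod (cdot (u x) (v x)) \<le> (norm (u x))\<^sup>2 + (norm (v x))\<^sup>2" for x
      by (rule order_trans[OF norm_cdot_le two_mult_le_squares])
  qed simp
  then show ?thesis by (rule abs_summable_summable)
qed

lemma l2_fun_summable: "(\<lambda>x. (norm (l2_fun v x))\<^sup>2) summable_on UNIV"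
  using l2_fun[of v] by simp

lemma l2_cinner_summable: "(\<lambda>x. cdot (l2_fun u x) (l2_fun v x)) summable_on UNIV"
  by (rule l2_cdot_summable) (rule l2_fun_summable)+

lemma l2_inner_summable: "(\<lambda>x. inner (l2_fun u x) (l2_fun v x)) summable_on UNIV"
  using summable_on_Re[OF l2_cinner_summable[of u v]] by (simp add: Re_cdot)

instantiation l2_sum :: (type, finite) real_inner
begin

lift_definition zero_l2_sum :: "('a, 'b) l2_sum" is "\<lambda>_. 0" by simp
lift_definition plus_l2_sum :: "('a, 'b) l2_sum \<Rightarrow> ('a, 'b) l2_sum \<Rightarrow> ('a, 'b) l2_sum"
  is "\<lambda>u v x. u x + v x" by (rule l2_add)
lift_definition uminus_l2_sum :: "('a, 'b) l2_sum \<Rightarrow> ('a, 'b) l2_sum"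
  is "\<lambda>v x. - v x" by simp
lift_definition minus_l2_sum :: "('a, 'b) l2_sum \<Rightarrow> ('a, 'b) l2_sum \<Rightarrow> ('a, 'b) l2_sum"
  is "\<lambda>u v x. u x - v x"
  subgoal for u v using l2_add[of u "\<lambda>x. - v x"] by simp
  done
lift_definition scaleR_l2_sum :: "real \<Rightarrow> ('a, 'b) l2_sum \<Rightarrow> ('a, 'b) l2_sum"
  is "\<lambda>r v x. r *\<^sub>R v x"
  subgoal for r v by (rule l2_bound[of v _ "\<bar>r\<bar>"]) simp_all
  done

definition inner_l2_sum :: "('a, 'b) l2_sum \<Rightarrow> ('a, 'b) l2_sum \<Rightarrow> real" where
  "inner_l2_sum u v = (\<Sum>\<^sub>\<infinity>x. inner (l2_fun u x) (l2_fun v x))"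
definition norm_l2_sum :: "('a, 'b) l2_sum \<Rightarrow> real" where
  "norm_l2_sum v = sqrt (inner v v)"
definition dist_l2_sum :: "('a, 'b) l2_sum \<Rightarrow> ('a, 'b) l2_sum \<Rightarrow> real" where
  "dist_l2_sum u v = norm (u - v)"
definition sgn_l2_sum :: "('a, 'b) l2_sum \<Rightarrow> ('a, 'b) l2_sum" where
  "sgn_l2_sum v = inverse (norm v) *\<^sub>R v"
definition uniformity_l2_sum :: "(('a, 'b) l2_sum \<times> ('a, 'b) l2_sum) filter" where
  "uniformity_l2_sum = (INF e\<in>{0<..}. principal {(u, v). dist u v < e})"
definition open_l2_sum :: "('a, 'b) l2_sum set \<Rightarrow> bool" where
  "open_l2_sum U \<longleftrightarrow> (\<forall>u\<in>U. \<forall>\<^sub>F (u', v) in uniformity. u' = u \<longrightarrow> v \<in> U)"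

lemmas l2_fun_simps = zero_l2_sum.rep_eq plus_l2_sum.rep_eq uminus_l2_sum.rep_eq
  minus_l2_sum.rep_eq scaleR_l2_sum.rep_eq

lemma l2_inner_self: "inner v v = (\<Sum>\<^sub>\<infinity>x. (norm (l2_fun v x))\<^sup>2)" for v :: "('a, 'b) l2_sum"
  by (simp add: inner_l2_sum_def power2_norm_eq_inner)

lemma l2_norm_sq: "(norm v)\<^sup>2 = (\<Sum>\<^sub>\<infinity>x. (norm (l2_fun v x))\<^sup>2)" for v :: "('a, 'b) l2_sum"
  unfolding norm_l2_sum_def l2_inner_self by (simp add: infsum_nonneg)

lemma l2_finite_sum_le: "finite F \<Longrightarrow> (\<Sum>x\<in>F. (norm (l2_fun v x))\<^sup>2) \<le> (norm v)\<^sup>2"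
  for v :: "('a, 'b) l2_sum"
  unfolding l2_norm_sq by (rule finite_sum_le_infsum[OF l2_fun_summable]) auto

lemma l2_component_le: "norm (l2_fun v x) \<le> norm v" for v :: "('a, 'b) l2_sum"
proof -
  have "(norm (l2_fun v x))\<^sup>2 \<le> (norm v)\<^sup>2"
    using l2_finite_sum_le[of "{x}" v] by simp
  moreover have "0 \<le> norm v"
    unfolding norm_l2_sum_def l2_inner_self by (simp add: infsum_nonneg)
  ultimately show ?thesis by (rule power2_le_imp_le)
qed

instance
proof
  fix u v w :: "('a, 'b) l2_sum" and r s :: real
  note eq = l2_fun_inject[symmetric] l2_fun_simps fun_eq_iff
  show "u + v + w = u + (v + w)" "u + v = v + u" "0 + u = u" "- u + u = 0" "u - v = u + - v"
    "r *\<^sub>R (u + v) = r *\<^sub>R u + r *\<^sub>R v" "(r + s) *\<^sub>R u = r *\<^sub>R u + s *\<^sub>R u"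
    "r *\<^sub>R s *\<^sub>R u = (r * s) *\<^sub>R u" "1 *\<^sub>R u = u"
    by (simp_all add: eq algebra_simps)
  show "inner u v = inner v u"
    by (simp add: inner_l2_sum_def inner_commute)
  show "inner (u + v) w = inner u w + inner v w"
    unfolding inner_l2_sum_def l2_fun_simps inner_add_left
    by (rule infsum_add) (rule l2_inner_summable)+
  show "inner (r *\<^sub>R u) v = r * inner u v"
    unfolding inner_l2_sum_def l2_fun_simps inner_scaleR_left
    by (rule infsum_cmult_right) (rule l2_inner_summable)
  show "0 \<le> inner u u" unfolding l2_inner_self by (simp add: infsum_nonneg)
  show "(inner u u = 0) = (u = 0)"
  proof
    assume "inner u u = 0"
    then have "norm u = 0" by (simp add: norm_l2_sum_def)
    then have "l2_fun u x = 0" for x using l2_component_le[of u x] by simp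
    then show "u = 0" by (simp add: eq)
  qed (simp add: l2_inner_self l2_fun_simps)
  show "norm u = sqrt (inner u u)" by (rule norm_l2_sum_def)
qed (rule dist_l2_sum_def sgn_l2_sum_def uniformity_l2_sum_def open_l2_sum_def)+

end

lemma l2_Cauchy_limit:
  fixes V :: "nat \<Rightarrow> ('x, 'n::finite) l2_sum"
  assumes "Cauchy V"
  shows "convergent V"
proof -
  have "\<exists>l. (\<lambda>k. l2_fun (V k) x) \<longlonglongrightarrow> l" for x
  proof -
    have "Cauchy (\<lambda>k. l2_fun (V k) x)"
    proof (rule CauchyI)
      fix e :: real assume "0 < e"
      then obtain N where N: "\<And>m k. m \<ge> N \<Longrightarrow> k \<ge> N \<Longrightarrow> norm (V m - V k) < e"
        using CauchyD[OF assms] by metis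
      have "norm (l2_fun (V m) x - l2_fun (V k) x) < e" if "m \<ge> N" "k \<ge> N" for m k
        using le_less_trans[OF l2_component_le[of "V m - V k" x] N[OF that]]
        by (simp add: l2_fun_simps)
      then show "\<exists>M. \<forall>m\<ge>M. \<forall>k\<ge>M. norm (l2_fun (V m) x - l2_fun (V k) x) < e" by blast
    qed
    then show ?thesis by (simp add: Cauchy_convergent_iff convergent_def)
  qed
  then obtain w where w: "\<And>x. (\<lambda>k. l2_fun (V k) x) \<longlonglongrightarrow> w x" by metis
  have bound: "(\<lambda>x. (norm (l2_fun (V k) x - w x))\<^sup>2) summable_on UNIV \<and>
      (\<Sum>\<^sub>\<infinity>x. (norm (l2_fun (V k) x - w x))\<^sup>2) \<le> e\<^sup>2"
    if "\<And>m. m \<ge> N \<Longrightarrow> norm (V k - V m) \<le> e" for k N e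
  proof -
    have fin: "(\<Sum>x\<in>F. (norm (l2_fun (V k) x - w x))\<^sup>2) \<le> e\<^sup>2" if "finite F" for F
    proof (rule LIMSEQ_le_const2)
      show "(\<lambda>m. \<Sum>x\<in>F. (norm (l2_fun (V k) x - l2_fun (V m) x))\<^sup>2)
          \<longlonglongrightarrow> (\<Sum>x\<in>F. (norm (l2_fun (V k) x - w x))\<^sup>2)"
        by (intro tendsto_intros w)
      have "(\<Sum>x\<in>F. (norm (l2_fun (V k) x - l2_fun (V m) x))\<^sup>2) \<le> e\<^sup>2" if "m \<ge> N" for m
        using l2_finite_sum_le[OF \<open>finite F\<close>, of "V k - V m"]
          power_mono[OF \<open>m \<ge> N \<Longrightarrow> norm (V k - V m) \<le> e\<close>[OF that] norm_ge_zero, of 2]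
        by (simp add: l2_fun_simps)
      then show "\<exists>N. \<forall>m\<ge>N. (\<Sum>x\<in>F. (norm (l2_fun (V k) x - l2_fun (V m) x))\<^sup>2) \<le> e\<^sup>2"
        by blast
    qed
    have "(\<lambda>x. (norm (l2_fun (V k) x - w x))\<^sup>2) summable_on UNIV"
      by (rule nonneg_bdd_above_summable_on) (auto intro!: bdd_aboveI[of _ "e\<^sup>2"] fin)
    then show ?thesis using fin by (auto intro: infsum_le_finite_sums)
  qed
  obtain N1 where "\<And>m k. m \<ge> N1 \<Longrightarrow> k \<ge> N1 \<Longrightarrow> norm (V m - V k) < 1"
    using CauchyD[OF assms zero_less_one] by metis
  then have "(\<lambda>x. (norm (l2_fun (V N1) x - w x))\<^sup>2) summable_on UNIV"
    using bound[of N1 N1 1] by (meson less_imp_le order_refl)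
  from l2_add[OF l2_fun_summable[of "V N1"] this[unfolded norm_minus_commute[of "l2_fun _ _"]]]
  have w_l2: "(\<lambda>x. (norm (w x))\<^sup>2) summable_on UNIV" by simp
  define W :: "('x, 'n) l2_sum" where "W = Abs_l2 w"
  have W: "l2_fun W = w" unfolding W_def using w_l2 by (simp add: Abs_l2_inverse)
  have "V \<longlonglongrightarrow> W"
  proof (rule LIMSEQ_I)
    fix e :: real assume e: "0 < e"
    then obtain N where N: "\<And>m k. m \<ge> N \<Longrightarrow> k \<ge> N \<Longrightarrow> norm (V m - V k) < e / 2"
      using CauchyD[OF assms, of "e / 2"] by auto
    have "norm (V k - W) < e" if "k \<ge> N" for k
    proof -
      have "(norm (V k - W))\<^sup>2 \<le> (e / 2)\<^sup>2"
        using bound[of N k "e / 2"] N[OF that]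
        by (simp add: l2_norm_sq l2_fun_simps W less_imp_le)
      then have "norm (V k - W) \<le> e / 2" by (rule power2_le_imp_le) (use e in simp)
      then show ?thesis using e by simp
    qed
    then show "\<exists>N. \<forall>k\<ge>N. norm (V k - W) < e" by blast
  qed
  then show ?thesis by (auto simp: convergent_def)
qed

instantiation l2_sum :: (type, finite) complex_hilbert
begin

lift_definition scaleC_l2_sum :: "complex \<Rightarrow> ('a, 'b) l2_sum \<Rightarrow> ('a, 'b) l2_sum"
  is "\<lambda>c v x. c *s v x"
  subgoal for c v by (rule l2_bound[of v _ "cmod c"]) (simp_all add: norm_scale_vec)
  done

definition cinner_l2_sum :: "('a, 'b) l2_sum \<Rightarrow> ('a, 'b) l2_sum \<Rightarrow> complex" where
  "cinner_l2_sum u v = (\<Sum>\<^sub>\<infinity>x. cdot (l2_fun u x) (l2_fun v x))"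

instance
proof
  fix u v w :: "('a, 'b) l2_sum" and c d :: complex and r :: real
  note eq = l2_fun_inject[symmetric] l2_fun_simps scaleC_l2_sum.rep_eq fun_eq_iff vec_eq_iff
  show "c *\<^sub>C (u + v) = c *\<^sub>C u + c *\<^sub>C v" "(c + d) *\<^sub>C v = c *\<^sub>C v + d *\<^sub>C v"
    "c *\<^sub>C d *\<^sub>C v = (c * d) *\<^sub>C v"
    by (simp_all add: eq algebra_simps)
  show "complex_of_real r *\<^sub>C v = r *\<^sub>R v"
    by (simp add: eq) (simp add: scaleR_conv_of_real)
  show "cinner u v = cnj (cinner v u)"
    unfolding cinner_l2_sum_def infsum_cnj[symmetric] by (subst cdot_commute) simp
  show "cinner u (v + w) = cinner u v + cinner u w"
    unfolding cinner_l2_sum_def l2_fun_simps cdot_add_right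
    by (rule infsum_add) (rule l2_cinner_summable)+
  show "cinner u (c *\<^sub>C v) = c * cinner u v"
    unfolding cinner_l2_sum_def scaleC_l2_sum.rep_eq cdot_scale_right
    by (rule infsum_cmult_right) (rule l2_cinner_summable)
  show "Re (cinner u v) = inner u v"
    unfolding cinner_l2_sum_def inner_l2_sum_def
    by (simp add: infsum_Re[OF l2_cinner_summable, symmetric] Re_cdot)
qed (rule l2_Cauchy_limit)

end


section \<open>The representation by multiplication operators\<close>

text \<open>For unbounded \<^term>\<open>f\<close> the pointwise product may leave the direct sum and
  \<open>mult_op f\<close> is a junk value; the lemmas below show that for bounded \<^term>\<open>f\<close> it is the
  intended bounded operator and that \<open>f\<close> can be recovered from it. Projection-valued
  functions are bounded.\<close>

definition mult_op :: "('x \<Rightarrow> complex^'n^'n) \<Rightarrow> (('x, 'n::finite) l2_sum \<Rightarrow>\<^sub>L ('x, 'n) l2_sum)" where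
  "mult_op f = Blinfun (\<lambda>v. Abs_l2 (\<lambda>x. f x *v l2_fun v x))"

lemma bounded_matrix_fun:
  fixes f :: "'x \<Rightarrow> complex^'n^'n"
  assumes "bounded (range f)"
  shows "\<exists>K. \<forall>x v. norm (f x *v v) \<le> K * norm v"
proof -
  obtain B where B: "\<And>x. norm (f x) \<le> B" using assms by (auto simp: bounded_iff)
  have "norm (f x *v v) \<le> (real CARD('n) * B) * norm v" for x v
  proof -
    have row: "norm ((f x *v v) $ i) \<le> B * norm v" for i
    proof -
      have "cmod (\<Sum>j\<in>UNIV. f x $ i $ j * v $ j)
          \<le> (\<Sum>j\<in>UNIV. \<bar>cmod (f x $ i $ j)\<bar> * \<bar>cmod (v $ j)\<bar>)"
        by (rule order_trans[OF norm_sum]) (simp add: norm_mult)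
      also have "\<dots> \<le> norm (f x $ i) * norm v" unfolding norm_vec_def[where 'a=complex]
        by (rule L2_set_mult_ineq)
      also have "\<dots> \<le> B * norm v"
        using order_trans[OF Finite_Cartesian_Product.norm_nth_le B, of x i]
        by (intro mult_right_mono) simp_all
      finally show ?thesis by (simp add: matrix_vector_mult_def)
    qed
    have "norm (f x *v v) \<le> (\<Sum>i\<in>UNIV. norm ((f x *v v) $ i))"
      unfolding norm_vec_def[of "f x *v v"] by (rule L2_set_le_sum) simp
    also have "\<dots> \<le> (\<Sum>i\<in>(UNIV :: 'n set). B * norm v)" by (intro sum_mono row)
    finally show ?thesis by (simp add: mult.assoc)
  qed
  then show ?thesis by blast
qed

lemma mult_op_apply:
  assumes "bounded (range f)"
  shows "l2_fun (blinfun_apply (mult_op f) v) x = f x *v l2_fun v x"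
proof -
  obtain K where K: "\<And>x v. norm (f x *v v) \<le> K * norm v"
    using bounded_matrix_fun[OF assms] by blast
  let ?M = "\<lambda>v. Abs_l2 (\<lambda>x. f x *v l2_fun v x)"
  have summable: "(\<lambda>x. (norm (f x *v l2_fun v x))\<^sup>2) summable_on UNIV" for v
    by (rule l2_bound[OF l2_fun_summable K])
  then have M: "l2_fun (?M v) x = f x *v l2_fun v x" for v x by (simp add: Abs_l2_inverse)
  have "bounded_linear ?M"
  proof (rule bounded_linear_intro)
    fix u v and r :: real
    show "?M (u + v) = ?M u + ?M v"
      unfolding l2_fun_inject[symmetric] fun_eq_iff plus_l2_sum.rep_eq[of "?M u"] M
      by (simp add: l2_fun_simps matrix_vector_right_distrib)
    show "?M (r *\<^sub>R v) = r *\<^sub>R ?M v"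
      unfolding l2_fun_inject[symmetric] fun_eq_iff scaleR_l2_sum.rep_eq[of _ "?M v"] M
      by (simp add: l2_fun_simps vec_eq_iff matrix_vector_mult_def scaleR_sum_right)
    have "(norm (?M v))\<^sup>2 \<le> (\<Sum>\<^sub>\<infinity>x. K\<^sup>2 * (norm (l2_fun v x))\<^sup>2)"
      unfolding l2_norm_sq M
    proof (rule infsum_mono[OF summable])
      show "(\<lambda>x. K\<^sup>2 * (norm (l2_fun v x))\<^sup>2) summable_on UNIV"
        by (intro summable_on_cmult_right l2_fun_summable)
      show "(norm (f x *v l2_fun v x))\<^sup>2 \<le> K\<^sup>2 * (norm (l2_fun v x))\<^sup>2" for x
        using power_mono[OF K norm_ge_zero, of x "l2_fun v x" 2]
        by (simp add: power_mult_distrib)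
    qed
    also have "\<dots> = (norm v * \<bar>K\<bar>)\<^sup>2"
      by (simp add: infsum_cmult_right' l2_norm_sq power_mult_distrib mult.commute)
    finally show "norm (?M v) \<le> norm v * \<bar>K\<bar>" by (rule power2_le_imp_le) simp
  qed
  then show ?thesis unfolding mult_op_def by (simp add: bounded_linear_Blinfun_apply M)
qed

lemma bounded_projection_matrices: "bounded (projection_matrices :: (complex^'n^'n) set)"
proof (rule boundedI)
  fix P :: "complex^'n^'n" assume "P \<in> projection_matrices"
  then have sym: "ctranspose P = P" and idem: "P ** P = P"
    by (auto simp: projection_matrices_def)
  have row: "norm (P $ i) \<le> 1" for i
  proof -
    have entry: "P $ j $ i = cnj (P $ i $ j)" for j
      using arg_cong[OF sym, of "\<lambda>M. M $ j $ i"] by (simp add: ctranspose_def)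
    have "P $ i $ i = (\<Sum>j\<in>UNIV. P $ i $ j * P $ j $ i)"
      using arg_cong[OF idem, of "\<lambda>M. M $ i $ i"] by (simp add: matrix_matrix_mult_def)
    also have "\<dots> = of_real ((norm (P $ i))\<^sup>2)"
      unfolding entry norm_vec_def L2_set_def
      by (simp add: sum_nonneg complex_norm_square[symmetric])
    finally have diag: "P $ i $ i = of_real ((norm (P $ i))\<^sup>2)" .
    have "(norm (P $ i))\<^sup>2 = cmod (P $ i $ i)" unfolding diag norm_of_real by simp
    also have "\<dots> \<le> norm (P $ i)" by (rule Finite_Cartesian_Product.norm_nth_le)
    finally show ?thesis by (cases "norm (P $ i) = 0") (simp_all add: power2_eq_square)
  qed
  have "norm P \<le> (\<Sum>i\<in>UNIV. norm (P $ i))"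
    unfolding norm_vec_def[of P] by (rule L2_set_le_sum) simp
  also have "\<dots> \<le> (\<Sum>i\<in>(UNIV :: 'n set). 1)" by (intro sum_mono row)
  finally show "norm P \<le> (\<Sum>i\<in>(UNIV :: 'n set). 1)" .
qed

lemma mult_op_bounded_ops: "bounded (range f) \<Longrightarrow> mult_op f \<in> bounded_ops"
  unfolding bounded_ops_def
  by (simp add: l2_fun_inject[symmetric] fun_eq_iff mult_op_apply scaleC_l2_sum.rep_eq
      vector_scalar_commute)

lemma inj_on_mult_op: "inj_on mult_op {f. bounded (range f)}"
proof (rule inj_onI, rule ext)
  fix f g :: "'x \<Rightarrow> complex^'n^'n" and x
  assume fg: "f \<in> {f. bounded (range f)}" "g \<in> {f. bounded (range f)}" "mult_op f = mult_op g"
  have "f x *v w = g x *v w" for w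
  proof -
    define v :: "('x, 'n) l2_sum" where "v = Abs_l2 (\<lambda>y. if y = x then w else 0)"
    have "(\<lambda>y. (norm (if y = x then w else 0))\<^sup>2) summable_on UNIV"
      by (rule finite_nonzero_values_imp_summable_on) (rule finite_subset[of _ "{x}"], auto)
    then have "l2_fun v x = w" unfolding v_def by (simp add: Abs_l2_inverse)
    then show ?thesis using fg mult_op_apply[of f v x] mult_op_apply[of g v x] by simp
  qed
  then show "f x = g x" by (simp add: matrix_eq)
qed

end

theory Submission
  imports Defs
begin

text \<open>For multiplication operators all relations between operators hold pointwise: order,
  positivity and being a projection of \<open>mult_op f\<close> are those of the matrices \<open>f x\<close>.  Suprema are
  pointwise as well (\<open>is_op_sup_mult_op\<close>): if a directed family of positive functions lies below \<open>q\<close>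
  and approximates \<open>q\<close> at each point, then \<open>mult_op q\<close> is its supremum among all self-adjoint
  operators.

  Let \<open>p\<close> be the supremum of an increasing net of continuous functions \<open>f\<close> with \<open>0 \<le> f \<le> 1\<close>.  At each
  point the matrices \<open>f x\<close> have a supremum \<open>m x\<close> to which they come arbitrarily close
  (\<open>directed_matrix_sup\<close>), so \<open>p = mult_op m\<close> by uniqueness of suprema, and \<open>m\<close> has projections as
  values.  From \<open>0 \<le> f y \<le> m y\<close> one gets \<open>(1 - m y) f y = 0\<close>, hence
  \<open>(1 - m y) m x = (1 - m y) (m x - f y)\<close>.  This is small for \<open>y\<close> near \<open>x\<close> as soon as \<open>f x\<close> is close to
  \<open>m x\<close>, and so \<open>m\<close> is lower semicontinuous.

  Conversely let \<open>p\<close> be lower semicontinuous.  The bounded continuous \<open>a \<ge> 0\<close> with \<open>p a = a\<close> are closed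
  under addition, and \<open>a \<mapsto> a (1 + a)\<^sup>-\<^sup>1\<close> is monotone (\<open>resolvent_antimono\<close>), so the functions
  \<open>a (1 + a)\<^sup>-\<^sup>1\<close> form a directed family of positive contractions, all of them below \<open>p\<close>.  Their
  supremum is \<open>p\<close> provided that they come close to \<open>p x\<close> at every \<open>x\<close>.  For this it is enough to find
  a bounded continuous \<open>b\<close> with \<open>p b = b\<close> and \<open>b x = p x\<close> (\<open>lsc_continuous_section\<close>), because then
  \<open>a = c b b\<^sup>*\<close> contributes the value \<open>c / (1 + c) p x\<close>, and \<open>c\<close> can be large.

  The section \<open>b\<close> is the heart of the matter.  It would follow from a selection theorem of Michael's
  type, but the rank gives a direct construction.  The Frobenius norm satisfies
  \<open>\<parallel>P - Q\<parallel>\<^sup>2 = tr P - tr Q + 2 \<parallel>(1 - P) Q\<parallel>\<^sup>2\<close> for projections, and traces of projections are discrete.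
  Hence the sets \<open>A\<^sub>j\<close> of points at which \<open>p\<close> has rank less than \<open>j\<close> are closed, and \<open>p\<close> is continuous
  on the difference of two consecutive ones.  If \<open>b\<close> is a continuous function with \<open>p b = b\<close>
  on \<open>A\<^sub>j\<close>, then \<open>p b\<close> is continuous on the next stratum: off \<open>A\<^sub>j\<close> because \<open>p\<close> is, and on \<open>A\<^sub>j\<close> by lower
  semicontinuity.  Tietze's theorem, which is where normality enters, extends \<open>p b\<close> to the whole space,
  and after finitely many steps \<open>p b = b\<close> everywhere.  The induction starts with the constant
  \<open>p x\<close> on the closure of the point \<open>x\<close>, where regularity keeps \<open>p\<close> from varying.

  The closed case follows by passing to complements.\<close>


section \<open>Complex matrices with the Frobenius norm\<close>

lemma norm_matrix_vector_mult_le: "norm (A *v v) \<le> norm A * norm v"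
  for A :: "complex^'n^'m"
proof -
  have row: "norm ((A *v v) $ i) \<le> norm (A $ i) * norm v" for i
  proof -
    have "cmod (\<Sum>j\<in>UNIV. A $ i $ j * v $ j) \<le> (\<Sum>j\<in>UNIV. \<bar>cmod (A $ i $ j)\<bar> * \<bar>cmod (v $ j)\<bar>)"
      by (rule order_trans[OF norm_sum]) (simp add: norm_mult)
    also have "\<dots> \<le> norm (A $ i) * norm v"
      unfolding norm_vec_def[where 'a=complex] by (rule L2_set_mult_ineq)
    finally show ?thesis by (simp add: matrix_vector_mult_def)
  qed
  have "norm (A *v v) \<le> L2_set (\<lambda>i. norm (A $ i) * norm v) UNIV"
    unfolding norm_vec_def[of "A *v v"] by (intro L2_set_mono row) simp
  also have "\<dots> = norm A * norm v"
    unfolding norm_vec_def[of A] by (rule L2_set_left_distrib[symmetric]) simp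
  finally show ?thesis .
qed

lemma matrix_vector_mult_axis: "(A *v axis j 1) $ i = (A $ i $ j :: complex)"
  by (simp add: matrix_vector_mult_def axis_def if_distrib cong: if_cong)

lemma matrix_scaleR_vector: "(r *\<^sub>R A) *v v = r *\<^sub>R (A *v v)" for A :: "complex^'n^'m"
  by (simp add: vec_eq_iff matrix_vector_mult_def scaleR_sum_right)

lemma norm_transpose: "norm (transpose A) = norm A" for A :: "complex^'n^'m"
proof -
  have "(norm (transpose A))\<^sup>2 = (norm A)\<^sup>2"
    unfolding power2_norm_eq_inner inner_vec_def transpose_def by (simp, rule sum.swap)
  then show ?thesis by simp
qed

lemma norm_matrix_mult_le: "norm (A ** B) \<le> norm A * norm B"
  for A :: "complex^'n^'m" and B :: "complex^'k^'n"
proof -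
  have col: "transpose (A ** B) $ j = A *v (transpose B $ j)" for j
    by (simp add: vec_eq_iff transpose_def matrix_matrix_mult_def matrix_vector_mult_def)
  have "norm (transpose (A ** B)) \<le> L2_set (\<lambda>j. norm A * norm (transpose B $ j)) UNIV"
    unfolding norm_vec_def[of "transpose (A ** B)"] col
    by (intro L2_set_mono norm_matrix_vector_mult_le) simp
  also have "\<dots> = norm A * norm (transpose B)"
    unfolding norm_vec_def[of "transpose B"] by (rule L2_set_right_distrib[symmetric]) simp
  finally show ?thesis by (simp add: norm_transpose)
qed

interpretation matrix_mult: bounded_bilinear "(**) :: complex^'n^'m \<Rightarrow> complex^'k^'n \<Rightarrow> complex^'k^'m"
proof
  show "\<exists>K. \<forall>a b. norm (a ** b :: complex^'k^'m) \<le> norm (a :: complex^'n^'m) * norm b * K"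
    by (intro exI[of _ 1]) (simp add: norm_matrix_mult_le)
qed (simp_all add: vec_eq_iff matrix_matrix_mult_def algebra_simps sum.distrib scaleR_sum_right)

lemma matrix_opnorm_le_norm: "matrix_opnorm M \<le> norm M"
  unfolding matrix_opnorm_def by (rule onorm_bound) (simp_all add: norm_matrix_vector_mult_le)

lemma norm_le_matrix_opnorm: "norm (M :: complex^'n^'n) \<le> real CARD('n) * (real CARD('n) * matrix_opnorm M)"
proof -
  have entry: "cmod (M $ i $ j) \<le> matrix_opnorm M" for i j
  proof -
    have "cmod (M $ i $ j) = norm ((M *v axis j 1) $ i)"
      by (simp add: matrix_vector_mult_axis)
    also have "\<dots> \<le> norm (M *v axis j 1)" by (rule Finite_Cartesian_Product.norm_nth_le)
    also have "\<dots> \<le> matrix_opnorm M * norm (axis j 1 :: complex^'n)"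
      unfolding matrix_opnorm_def by (rule onorm) simp
    finally show ?thesis by simp
  qed
  have "norm M \<le> (\<Sum>i\<in>UNIV. norm (M $ i))"
    unfolding norm_vec_def[of M] by (rule L2_set_le_sum) simp
  also have "\<dots> \<le> (\<Sum>i\<in>(UNIV::'n set). real CARD('n) * matrix_opnorm M)"
  proof (rule sum_mono)
    fix i
    have "norm (M $ i) \<le> (\<Sum>j\<in>UNIV. cmod (M $ i $ j))"
      unfolding norm_vec_def[of "M $ i"] by (rule L2_set_le_sum) simp
    also have "\<dots> \<le> (\<Sum>j\<in>(UNIV::'n set). matrix_opnorm M)" by (intro sum_mono entry)
    finally show "norm (M $ i) \<le> real CARD('n) * matrix_opnorm M" by simp
  qed
  finally show ?thesis by simp
qed

text \<open>On a space of finite dimension all norms are equivalent, so lower semicontinuity is a limit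
  in the Frobenius norm.\<close>

lemma lower_semicontinuous_iff_tendsto:
  fixes p :: "'x::topological_space \<Rightarrow> complex^'n^'n"
  shows "lower_semicontinuous p \<longleftrightarrow> (\<forall>x. ((\<lambda>y. (mat 1 - p y) ** p x) \<longlongrightarrow> 0) (nhds x))"
proof -
  have "((g \<longlongrightarrow> 0) F) \<longleftrightarrow> (\<forall>\<epsilon>>0. \<forall>\<^sub>F y in F. matrix_opnorm (g y) < \<epsilon>)"
    for g :: "'x \<Rightarrow> complex^'n^'n" and F
  proof
    assume g: "(g \<longlongrightarrow> 0) F"
    show "\<forall>\<epsilon>>0. \<forall>\<^sub>F y in F. matrix_opnorm (g y) < \<epsilon>"
    proof (intro allI impI)
      fix \<epsilon> :: real assume "\<epsilon> > 0"
      from tendstoD[OF g this] show "\<forall>\<^sub>F y in F. matrix_opnorm (g y) < \<epsilon>"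
        by eventually_elim (simp add: dist_norm le_less_trans[OF matrix_opnorm_le_norm])
    qed
  next
    assume op: "\<forall>\<epsilon>>0. \<forall>\<^sub>F y in F. matrix_opnorm (g y) < \<epsilon>"
    have nn: "0 \<le> matrix_opnorm M" for M :: "complex^'n^'n"
      unfolding matrix_opnorm_def by (rule onorm_pos_le) simp
    have "((\<lambda>y. matrix_opnorm (g y)) \<longlongrightarrow> 0) F"
      by (rule tendstoI) (use op nn in \<open>simp add: dist_real_def\<close>)
    then have "((\<lambda>y. real CARD('n) * (real CARD('n) * matrix_opnorm (g y))) \<longlongrightarrow> 0) F"
      by (intro tendsto_mult_right_zero)
    then show "(g \<longlongrightarrow> 0) F"
      by (rule Lim_null_comparison[rotated]) (intro always_eventually allI norm_le_matrix_opnorm)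
  qed
  then show ?thesis unfolding lower_semicontinuous_def by simp
qed


section \<open>Adjoints, positive matrices and projections\<close>

lemma ctranspose_algebra:
  "ctranspose (A + B) = ctranspose A + ctranspose B"
  "ctranspose (A - B) = ctranspose A - ctranspose B"
  "ctranspose (A ** B) = ctranspose B ** ctranspose A"
  "ctranspose (mat 1) = mat 1"
  "ctranspose (ctranspose A) = A"
  "ctranspose 0 = 0"
  "ctranspose (r *\<^sub>R A) = r *\<^sub>R ctranspose A"
  by (auto simp: ctranspose_def vec_eq_iff matrix_matrix_mult_def mat_def cnj_sum mult.commute)

lemma cdot_matrix_left: "cdot (A *v u) v = cdot u (ctranspose A *v v)"
proof -
  have "cdot (A *v u) v = (\<Sum>i\<in>UNIV. \<Sum>j\<in>UNIV. cnj (A $ i $ j) * cnj (u $ j) * v $ i)"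
    by (simp add: cdot_def matrix_vector_mult_def cnj_sum sum_distrib_right)
  also have "\<dots> = (\<Sum>j\<in>UNIV. \<Sum>i\<in>UNIV. cnj (A $ i $ j) * cnj (u $ j) * v $ i)"
    by (rule sum.swap)
  also have "\<dots> = cdot u (ctranspose A *v v)"
    by (simp add: cdot_def matrix_vector_mult_def ctranspose_def sum_distrib_left mult_ac)
  finally show ?thesis .
qed

lemma inner_matrix_left: "inner (A *v u) v = inner u (ctranspose A *v v)" for A :: "complex^'n^'n"
  by (simp flip: Re_cdot add: cdot_matrix_left)

lemma matrix_zeroI:
  assumes "\<And>v. M *v v = 0" shows "M = (0 :: complex^'n^'n)"
  using assms by (simp add: matrix_eq)

lemma inner_matrix: "inner A B = Re (trace (ctranspose A ** B))" for A B :: "complex^'n^'n"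
proof -
  have "inner A B = (\<Sum>i\<in>UNIV. \<Sum>j\<in>UNIV. Re (cnj (A $ i $ j) * B $ i $ j))"
    by (simp add: inner_vec_def inner_complex_def)
  also have "\<dots> = (\<Sum>j\<in>UNIV. \<Sum>i\<in>UNIV. Re (cnj (A $ i $ j) * B $ i $ j))"
    by (rule sum.swap)
  finally show ?thesis
    by (simp add: trace_def matrix_matrix_mult_def ctranspose_def Re_sum)
qed

lemma norm_ctranspose: "norm (ctranspose A) = norm A" for A :: "complex^'n^'n"
proof -
  have "(norm (ctranspose A))\<^sup>2 = (norm A)\<^sup>2"
    unfolding power2_norm_eq_inner inner_matrix ctranspose_algebra by (subst trace_mul_sym) (rule refl)
  then show ?thesis by simp
qed

definition positive_matrix :: "complex^'n^'n \<Rightarrow> bool" where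
  "positive_matrix M \<longleftrightarrow> ctranspose M = M \<and> (\<forall>v. 0 \<le> inner v (M *v v))"

lemma positive_matrix_add: "positive_matrix A \<Longrightarrow> positive_matrix B \<Longrightarrow> positive_matrix (A + B)"
  by (simp add: positive_matrix_def ctranspose_algebra matrix_vector_mult_add_rdistrib inner_add_right)

lemma positive_matrix_scaleR: "0 \<le> r \<Longrightarrow> positive_matrix A \<Longrightarrow> positive_matrix (r *\<^sub>R A)"
  by (simp add: positive_matrix_def ctranspose_algebra matrix_scaleR_vector)

lemma positive_matrix_mult_ctranspose: "positive_matrix (A ** ctranspose A)"
proof -
  have "inner v (A ** ctranspose A *v v) = inner (ctranspose A *v v) (ctranspose A *v v)" for v
    by (simp add: inner_matrix_left ctranspose_algebra matrix_vector_mul_assoc)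
  then show ?thesis by (simp add: positive_matrix_def ctranspose_algebra)
qed

lemma projection_positive: "P \<in> projection_matrices \<Longrightarrow> positive_matrix P"
  using positive_matrix_mult_ctranspose[of P] by (simp add: projection_matrices_def)

lemma projection_complement: "P \<in> projection_matrices \<Longrightarrow> mat 1 - P \<in> projection_matrices"
  by (simp add: projection_matrices_def ctranspose_algebra matrix_mult.diff_left matrix_mult.diff_right)

text \<open>Positivity on \<^term>\<open>u + v\<close> and \<^term>\<open>u - v\<close> gives this form of the Cauchy--Schwarz
  inequality.\<close>

lemma positive_matrix_cauchy_schwarz:
  assumes "positive_matrix M"
  shows "2 * \<bar>inner u (M *v v)\<bar> \<le> inner u (M *v u) + inner v (M *v v)"
proof -
  have sym: "inner v (M *v u) = inner u (M *v v)"
    using assms by (metis inner_commute inner_matrix_left positive_matrix_def)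
  have "0 \<le> inner (u + v) (M *v (u + v))" "0 \<le> inner (u - v) (M *v (u - v))"
    using assms by (simp_all add: positive_matrix_def)
  then show ?thesis using sym
    by (simp add: matrix_vector_right_distrib matrix_vector_mult_diff_distrib inner_simps)
qed

text \<open>Each entry is bounded by the mean of two diagonal entries, so the trace controls the norm.\<close>

lemma norm_positive_le_trace:
  fixes M :: "complex^'n^'n"
  assumes "positive_matrix M"
  shows "norm M \<le> real CARD('n) * Re (trace M)"
proof -
  have diag: "inner (axis i 1) (M *v axis i 1) = Re (M $ i $ i)" for i
    by (simp add: inner_axis' matrix_vector_mult_axis inner_complex_def)
  have entry: "2 * cmod (M $ i $ j) \<le> Re (M $ i $ i) + Re (M $ j $ j)" for i j
  proof -
    \<comment> \<open>The phase \<open>c\<close> makes the off-diagonal entry real and nonnegative.\<close>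
    obtain c where c: "cmod c = 1" "c * M $ i $ j = of_real (cmod (M $ i $ j))"
    proof
      show "cmod (cis (- Arg (M $ i $ j))) = 1" by simp
      have "cis (- Arg (M $ i $ j)) * rcis (cmod (M $ i $ j)) (Arg (M $ i $ j)) = of_real (cmod (M $ i $ j))"
        by (simp add: rcis_def cis_mult)
      then show "cis (- Arg (M $ i $ j)) * M $ i $ j = of_real (cmod (M $ i $ j))"
        by (simp add: rcis_cmod_Arg)
    qed
    let ?v = "c *s axis j 1"
    have "Re (cdot ?v (M *v ?v)) = Re (cdot (axis j 1) (M *v axis j 1))"
    proof -
      have "cdot ?v (M *v ?v) = c * cnj (c * cdot (M *v axis j 1) (axis j 1))"
        by (metis cdot_commute cdot_scale_right vector_scalar_commute)
      also have "\<dots> = (c * cnj c) * cdot (axis j 1) (M *v axis j 1)"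
        by (subst (2) cdot_commute) (simp add: mult.assoc)
      also have "c * cnj c = 1" using c by (simp flip: complex_norm_square)
      finally show ?thesis by simp
    qed
    then have jj: "inner ?v (M *v ?v) = Re (M $ j $ j)" by (simp add: Re_cdot diag)
    have "inner (axis i 1) (M *v ?v) = Re (c * M $ i $ j)"
      by (simp add: vector_scalar_commute inner_axis' matrix_vector_mult_axis inner_complex_def)
    then show ?thesis
      using positive_matrix_cauchy_schwarz[OF assms, of "axis i 1" ?v] jj diag c by simp
  qed
  have "norm M \<le> (\<Sum>i\<in>UNIV. norm (M $ i))"
    unfolding norm_vec_def[of M] by (rule L2_set_le_sum) simp
  also have "\<dots> \<le> (\<Sum>i\<in>UNIV. \<Sum>j\<in>UNIV. cmod (M $ i $ j))"
    unfolding norm_vec_def[where 'a=complex] by (intro sum_mono L2_set_le_sum) simp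
  also have "\<dots> \<le> (\<Sum>i\<in>UNIV. \<Sum>j\<in>UNIV. (Re (M $ i $ i) + Re (M $ j $ j)) / 2)"
    using entry by (intro sum_mono) (simp add: mult.commute)
  also have "\<dots> = real CARD('n) * Re (trace M)"
    by (simp add: trace_def Re_sum sum.distrib add_divide_distrib flip: sum_divide_distrib sum_distrib_left)
  finally show ?thesis .
qed

text \<open>For \<open>0 \<le> M \<le> 1\<close> one has \<open>M\<^sup>2 \<le> M\<close>: evaluate the form of \<open>M\<close> at \<open>Mv - v\<close>.\<close>

lemma positive_contraction_square_le:
  assumes "positive_matrix M" "positive_matrix (mat 1 - M)"
  shows "(norm (M *v v))\<^sup>2 \<le> inner v (M *v v)"
proof -
  let ?w = "M *v v"
  have "0 \<le> inner (?w - v) (M *v (?w - v))" using assms(1) by (simp add: positive_matrix_def)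
  moreover have "inner v (M *v ?w) = inner ?w ?w"
    using assms(1) by (simp add: positive_matrix_def inner_matrix_left)
  moreover have "0 \<le> inner ?w ((mat 1 - M) *v ?w)"
    using assms(2) by (simp add: positive_matrix_def)
  ultimately show ?thesis
    by (simp add: matrix_vector_mult_diff_distrib matrix_vector_mult_diff_rdistrib inner_simps
        power2_norm_eq_inner)
qed

lemma positive_contraction_norm_le:
  assumes "positive_matrix M" "positive_matrix (mat 1 - M)"
  shows "norm (M *v v) \<le> norm v"
proof -
  have "0 \<le> inner v ((mat 1 - M) *v v)" using assms(2) by (simp add: positive_matrix_def)
  then have "(norm (M *v v))\<^sup>2 \<le> (norm v)\<^sup>2"
    using positive_contraction_square_le[OF assms, of v]
    by (simp add: matrix_vector_mult_diff_rdistrib inner_simps power2_norm_eq_inner)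
  then show ?thesis by (rule power2_le_imp_le) simp
qed

lemma norm_positive_contraction_le:
  fixes M :: "complex^'n^'n"
  assumes "positive_matrix M" "positive_matrix (mat 1 - M)"
  shows "norm M \<le> real CARD('n) * real CARD('n)"
proof -
  have "matrix_opnorm M \<le> 1"
    unfolding matrix_opnorm_def
    by (rule onorm_bound) (simp_all add: positive_contraction_norm_le assms)
  then have "real CARD('n) * matrix_opnorm M \<le> real CARD('n) * 1" by (rule mult_left_mono) simp
  then have "real CARD('n) * (real CARD('n) * matrix_opnorm M) \<le> real CARD('n) * (real CARD('n) * 1)"
    by (rule mult_left_mono) simp
  with norm_le_matrix_opnorm[of M] show ?thesis by (simp only: mult_1_right)
qed

text \<open>Compress \<open>M\<close> to the kernel of \<open>P\<close>: \<open>0 \<le> (1-P)M(1-P) \<le> (1-P)P(1-P) = 0\<close>.\<close>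

lemma positive_below_projection:
  assumes P: "P \<in> projection_matrices" and M: "positive_matrix M" and le: "positive_matrix (P - M)"
  shows "P ** M = M"
proof -
  have one: "positive_matrix (mat 1 - M)"
    using positive_matrix_add[OF le projection_positive[OF projection_complement[OF P]]] by simp
  have "M ** (mat 1 - P) = 0"
  proof (rule matrix_zeroI)
    fix v
    let ?w = "(mat 1 - P) *v v"
    have "P *v ?w = 0"
      using P by (simp add: projection_matrices_def matrix_vector_mul_assoc matrix_mult.diff_right)
    moreover have "0 \<le> inner ?w ((P - M) *v ?w)" using le by (simp add: positive_matrix_def)
    ultimately have "inner ?w (M *v ?w) \<le> 0"
      by (simp add: matrix_vector_mult_diff_rdistrib inner_simps)
    with positive_contraction_square_le[OF M one, of ?w] have "(norm (M *v ?w))\<^sup>2 \<le> 0" by linarith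
    then have "M *v ?w = 0" by simp
    then show "(M ** (mat 1 - P)) *v v = 0" by (simp add: matrix_vector_mul_assoc)
  qed
  then have "ctranspose (M ** (mat 1 - P)) = 0" by (simp add: ctranspose_algebra)
  then show ?thesis
    using P M by (simp add: ctranspose_algebra projection_matrices_def positive_matrix_def
        matrix_mult.diff_left)
qed

text \<open>Here \<open>P - M = P (1 - M) P\<close>.\<close>

lemma projection_dominates:
  assumes P: "P \<in> projection_matrices" and M: "positive_matrix M" "positive_matrix (mat 1 - M)"
    and PM: "P ** M = M"
  shows "positive_matrix (P - M)"
proof -
  have herm: "ctranspose P = P" "ctranspose M = M" and PP: "P ** P = P"
    using P M by (auto simp: projection_matrices_def positive_matrix_def)
  have MP: "M ** P = M" using arg_cong[OF PM, of ctranspose] herm by (simp add: ctranspose_algebra)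
  have "P - M = P ** (mat 1 - M) ** P"
    by (simp add: matrix_mult.diff_left matrix_mult.diff_right PP PM MP)
  then have "inner v ((P - M) *v v) = inner (P *v v) ((mat 1 - M) *v (P *v v))" for v
    by (simp add: inner_matrix_left herm matrix_vector_mul_assoc matrix_mul_assoc)
  then show ?thesis using M(2) herm by (simp add: positive_matrix_def ctranspose_algebra)
qed


section \<open>Traces of projections\<close>

text \<open>For the Frobenius norm the distance of two projections splits into the difference of their
  traces and the quantity that lower semicontinuity controls.  This shows at once that the trace of
  a lower semicontinuous \<open>p\<close> is lower semicontinuous and that \<open>p\<close> is continuous where its trace
  does not increase.\<close>

lemma norm_projection_diff_sq:
  assumes "P \<in> projection_matrices" "Q \<in> projection_matrices"
  shows "(norm (P - Q))\<^sup>2 = Re (trace P) - Re (trace Q) + 2 * (norm ((mat 1 - P) ** Q))\<^sup>2"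
proof -
  have P: "ctranspose P = P" "P ** P = P" and Q: "ctranspose Q = Q" "Q ** Q = Q"
    using assms by (auto simp: projection_matrices_def)
  have "trace (Q ** (P ** Q)) = trace (P ** Q)"
    by (subst trace_mul_sym) (simp add: Q flip: matrix_mul_assoc)
  then have "inner P P = Re (trace P)" "inner Q Q = Re (trace Q)"
    "inner P Q = Re (trace (P ** Q))" "inner Q (P ** Q) = Re (trace (P ** Q))"
    "inner (P ** Q) (P ** Q) = Re (trace (P ** Q))"
    using P Q by (simp_all add: inner_matrix ctranspose_algebra)
      (metis matrix_mul_assoc)
  then show ?thesis
    by (simp add: power2_norm_eq_inner inner_diff_left inner_diff_right matrix_mult.diff_left inner_commute)
qed

text \<open>Expanding in a real orthonormal basis of the range shows that the trace counts half its real
  dimension, so that traces of projections are discrete.\<close>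

lemma trace_projection:
  fixes P :: "complex^'n^'n"
  assumes "P \<in> projection_matrices"
  shows "2 * Re (trace P) = real (dim (range ((*v) P)))"
proof -
  have P: "ctranspose P = P" "P ** P = P"
    using assms by (auto simp: projection_matrices_def)
  let ?S = "range ((*v) P)"
  have "subspace ?S" by (simp add: linear_subspace_image)
  then obtain B where B: "B \<subseteq> ?S" "pairwise orthogonal B" "\<And>b. b \<in> B \<Longrightarrow> norm b = 1"
      "independent B" "card B = dim ?S" "span B = ?S"
    using orthonormal_basis_subspace by metis
  have "finite B" using B(4) by (rule independent_imp_finite)
  have fixB: "P *v b = b" if "b \<in> B" for b
    using B(1) that P(2) by (auto simp: matrix_vector_mul_assoc)
  have expand: "P *v v = (\<Sum>b\<in>B. inner b v *\<^sub>R b)" for v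
  proof -
    have "(\<Sum>b\<in>B. inner (P *v v) b *\<^sub>R b) = P *v v"
      by (rule orthonormal_basis_expand) (use B \<open>finite B\<close> in auto)
    moreover have "inner (P *v v) b = inner b v" if "b \<in> B" for b
      using fixB[OF that] by (metis P(1) inner_commute inner_matrix_left)
    ultimately show ?thesis by simp
  qed
  have form: "inner v (P *v v) = (\<Sum>b\<in>B. (inner b v)\<^sup>2)" for v
    unfolding expand inner_sum_right by (simp add: power2_eq_square inner_commute)
  have "2 * Re (trace P) = (\<Sum>j\<in>UNIV. inner (axis j 1) (P *v axis j 1) + inner (axis j \<i>) (P *v axis j \<i>))"
  proof -
    have "axis j \<i> = \<i> *s axis j (1::complex)" for j :: 'n
      by (simp add: vec_eq_iff axis_def)
    then have "(P *v axis j \<i>) $ j = \<i> * P $ j $ j" for j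
      by (simp add: vector_scalar_commute matrix_vector_mult_axis)
    then show ?thesis
      by (simp add: inner_axis' matrix_vector_mult_axis inner_complex_def
          trace_def Re_sum sum_distrib_left)
  qed
  also have "\<dots> = (\<Sum>j\<in>UNIV. \<Sum>b\<in>B. (cmod (b $ j))\<^sup>2)"
    unfolding form by (simp add: inner_axis inner_complex_def cmod_power2 flip: sum.distrib)
  also have "\<dots> = (\<Sum>b\<in>B. \<Sum>j\<in>UNIV. (cmod (b $ j))\<^sup>2)" by (rule sum.swap)
  also have "\<dots> = (\<Sum>b\<in>B. (norm b)\<^sup>2)"
    by (intro sum.cong refl) (simp add: norm_vec_def L2_set_def sum_nonneg)
  also have "\<dots> = real (dim ?S)" using B by simp
  finally show ?thesis .
qed

text \<open>Twice the complex rank.\<close>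

definition real_rank :: "complex^'n^'n \<Rightarrow> nat" where
  "real_rank P = dim (range ((*v) P))"

lemma norm_projection_diff_sq_rank:
  assumes "P \<in> projection_matrices" "Q \<in> projection_matrices"
  shows "2 * (norm (P - Q))\<^sup>2
    = real (real_rank P) - real (real_rank Q) + 4 * (norm ((mat 1 - P) ** Q))\<^sup>2"
  using norm_projection_diff_sq[OF assms] trace_projection[OF assms(1)] trace_projection[OF assms(2)]
  unfolding real_rank_def by linarith

section \<open>Lower semicontinuous projections and their continuous sections\<close>

lemma lsc_projections_iff:
  "p \<in> lsc_projections \<longleftrightarrow> (\<forall>x. p x \<in> projection_matrices) \<and>
     (\<forall>x. ((\<lambda>y. (mat 1 - p y) ** p x) \<longlongrightarrow> 0) (nhds x))"
  by (auto simp: lsc_projections_def lower_semicontinuous_iff_tendsto)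

lemma lsc_rank_eventually_ge:
  assumes "p \<in> lsc_projections"
  shows "\<forall>\<^sub>F y in nhds x. real_rank (p x) \<le> real_rank (p y)"
proof -
  have proj: "\<And>y. p y \<in> projection_matrices"
    and lim: "((\<lambda>y. (mat 1 - p y) ** p x) \<longlongrightarrow> 0) (nhds x)"
    using assms by (auto simp: lsc_projections_iff)
  \<comment> \<open>At this distance the rank can drop by less than \<open>1\<close>, hence not at all.\<close>
  from tendstoD[OF lim, of "1/2"] have "\<forall>\<^sub>F y in nhds x. norm ((mat 1 - p y) ** p x) < 1/2"
    by (simp add: dist_norm)
  then show ?thesis
  proof eventually_elim
    case (elim y)
    then have "(norm ((mat 1 - p y) ** p x))\<^sup>2 < (1/2)\<^sup>2" by (intro power_strict_mono) auto
    moreover have "0 \<le> 2 * (norm (p y - p x))\<^sup>2" by simp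
    ultimately have "real (real_rank (p x)) < real (real_rank (p y)) + 1"
      using norm_projection_diff_sq_rank[OF proj[of y] proj[of x]] by (simp add: power_divide)
    then show ?case by linarith
  qed
qed

lemma closed_lsc_rank_less:
  assumes "p \<in> lsc_projections"
  shows "closed {y. real_rank (p y) < j}"
proof -
  have "open {y. j \<le> real_rank (p y)}"
  proof (subst open_subopen, safe)
    fix x assume "j \<le> real_rank (p x)"
    with lsc_rank_eventually_ge[OF assms, of x]
    have "\<forall>\<^sub>F y in nhds x. j \<le> real_rank (p y)" by (auto elim: eventually_mono)
    then show "\<exists>T. open T \<and> x \<in> T \<and> T \<subseteq> {y. j \<le> real_rank (p y)}"
      unfolding eventually_nhds by blast
  qed
  moreover have "- {y. real_rank (p y) < j} = {y. j \<le> real_rank (p y)}" by auto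
  ultimately show ?thesis unfolding closed_def by simp
qed

lemma lsc_tendsto_of_rank_le:
  assumes p: "p \<in> lsc_projections" and rank: "\<forall>\<^sub>F y in at x within A. real_rank (p y) \<le> real_rank (p x)"
  shows "(p \<longlongrightarrow> p x) (at x within A)"
proof -
  have proj: "\<And>y. p y \<in> projection_matrices"
    and lim: "((\<lambda>y. (mat 1 - p y) ** p x) \<longlongrightarrow> 0) (nhds x)"
    using p by (auto simp: lsc_projections_iff)
  have le: "at x within A \<le> nhds x" by (simp add: at_within_def)
  have "((\<lambda>y. 2 * norm ((mat 1 - p y) ** p x)) \<longlongrightarrow> 0) (at x within A)"
    using lim le by (intro tendsto_mult_right_zero tendsto_norm_zero) (rule tendsto_mono)
  moreover have "\<forall>\<^sub>F y in at x within A. norm (p y - p x) \<le> 2 * norm ((mat 1 - p y) ** p x)"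
    using rank
  proof eventually_elim
    case (elim y)
    have "(2 * norm ((mat 1 - p y) ** p x))\<^sup>2 = 4 * (norm ((mat 1 - p y) ** p x))\<^sup>2"
      by (simp add: power_mult_distrib)
    moreover have "real (real_rank (p y)) \<le> real (real_rank (p x))" using elim by simp
    moreover have "0 \<le> (norm ((mat 1 - p y) ** p x))\<^sup>2" by simp
    ultimately have "(norm (p y - p x))\<^sup>2 \<le> (2 * norm ((mat 1 - p y) ** p x))\<^sup>2"
      using norm_projection_diff_sq_rank[OF proj[of y] proj[of x]] by linarith
    then show ?case by (rule power2_le_imp_le) simp
  qed
  ultimately have "((\<lambda>y. p y - p x) \<longlongrightarrow> 0) (at x within A)"
    by (rule Lim_null_comparison[rotated])
  then show ?thesis by (simp add: LIM_zero_iff)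
qed

lemma bounded_projection_valued: "(\<And>x. p x \<in> projection_matrices) \<Longrightarrow> bounded (range p)"
  by (rule bounded_subset[OF bounded_projection_matrices]) auto

lemma bounded_matrix_product:
  fixes f :: "'x \<Rightarrow> complex^'n^'m" and g :: "'x \<Rightarrow> complex^'k^'n"
  assumes "bounded (f ` A)" "bounded (g ` A)"
  shows "bounded ((\<lambda>x. f x ** g x) ` A)"
proof -
  obtain F G where F: "\<And>x. x \<in> A \<Longrightarrow> norm (f x) \<le> F" and G: "\<And>x. x \<in> A \<Longrightarrow> norm (g x) \<le> G"
    using assms by (auto simp: bounded_iff)
  have "norm (f x ** g x) \<le> F * G" if "x \<in> A" for x
    using norm_matrix_mult_le[of "f x" "g x"]
      mult_mono[OF F[OF that] G[OF that] order_trans[OF norm_ge_zero F[OF that]] norm_ge_zero]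
    by linarith
  then show ?thesis by (auto simp: bounded_iff)
qed

lemma Tietze_matrix:
  fixes f :: "'x::topological_space \<Rightarrow> complex^'n^'m"
  assumes normal: "normal_space (euclidean :: 'x topology)"
    and S: "closed S" and cont: "continuous_on S f" and bdd: "bounded (f ` S)"
  obtains g where "continuous_on UNIV g" "bounded (range g)" "\<And>x. x \<in> S \<Longrightarrow> g x = f x"
proof -
  obtain B where B: "\<And>x. x \<in> S \<Longrightarrow> norm (f x) \<le> B" and B0: "0 < B"
    using bdd unfolding bounded_pos by auto
  have entry: "cmod (f x $ i $ j) \<le> B" if "x \<in> S" for x i j
    using Finite_Cartesian_Product.norm_nth_le[of "f x" i] B[OF that]
      Finite_Cartesian_Product.norm_nth_le[of "f x $ i" j] by linarith
  have ext: "\<exists>g. continuous_on UNIV g \<and> range g \<subseteq> {-B..B} \<and> (\<forall>x\<in>S. g x = h x)"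
    if "continuous_on S h" "\<And>x. x \<in> S \<Longrightarrow> \<bar>h x\<bar> \<le> B" for h :: "'x \<Rightarrow> real"
  proof -
    have "continuous_map (subtopology euclidean S) euclideanreal h" "h ` S \<subseteq> {-B..B}"
      using that by (auto simp: abs_le_iff) (smt (verit) that(2))
    then show ?thesis
      by - (rule Tietze_extension_realinterval[OF normal, of S "{-B..B}" h],
          use S B0 in \<open>auto simp: is_interval_cc\<close>)
  qed
  have "\<exists>g. continuous_on UNIV g \<and> range g \<subseteq> {-B..B} \<and> (\<forall>x\<in>S. g x = Re (f x $ i $ j))" for i j
  proof (rule ext)
    show "continuous_on S (\<lambda>x. Re (f x $ i $ j))" by (intro continuous_intros cont)
    show "\<bar>Re (f x $ i $ j)\<bar> \<le> B" if "x \<in> S" for x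
      using entry[OF that, of i j] abs_Re_le_cmod[of "f x $ i $ j"] by linarith
  qed
  then obtain u where u: "\<And>i j. continuous_on UNIV (u i j)" "\<And>i j. range (u i j) \<subseteq> {-B..B}"
      "\<And>i j x. x \<in> S \<Longrightarrow> u i j x = Re (f x $ i $ j)" by metis
  have "\<exists>g. continuous_on UNIV g \<and> range g \<subseteq> {-B..B} \<and> (\<forall>x\<in>S. g x = Im (f x $ i $ j))" for i j
  proof (rule ext)
    show "continuous_on S (\<lambda>x. Im (f x $ i $ j))" by (intro continuous_intros cont)
    show "\<bar>Im (f x $ i $ j)\<bar> \<le> B" if "x \<in> S" for x
      using entry[OF that, of i j] abs_Im_le_cmod[of "f x $ i $ j"] by linarith
  qed
  then obtain v where v: "\<And>i j. continuous_on UNIV (v i j)" "\<And>i j. range (v i j) \<subseteq> {-B..B}"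
      "\<And>i j x. x \<in> S \<Longrightarrow> v i j x = Im (f x $ i $ j)" by metis
  let ?g = "\<lambda>x. (\<chi> i j. Complex (u i j x) (v i j x)) :: complex^'n^'m"
  have "norm (?g x) \<le> (\<Sum>i\<in>(UNIV::'m set). \<Sum>j\<in>(UNIV::'n set). B + B)" for x
  proof -
    have "norm (?g x) \<le> (\<Sum>i\<in>UNIV. norm (?g x $ i))"
      unfolding norm_vec_def[of "?g x"] by (rule L2_set_le_sum) simp
    also have "\<dots> \<le> (\<Sum>i\<in>UNIV. \<Sum>j\<in>UNIV. cmod (?g x $ i $ j))"
      unfolding norm_vec_def[where 'a=complex] by (intro sum_mono L2_set_le_sum) simp
    also have "\<dots> \<le> (\<Sum>i\<in>(UNIV::'m set). \<Sum>j\<in>(UNIV::'n set). B + B)"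
    proof (intro sum_mono)
      fix i j
      have "\<bar>u i j x\<bar> \<le> B" "\<bar>v i j x\<bar> \<le> B"
        using subsetD[OF u(2) rangeI, of i j x] subsetD[OF v(2) rangeI, of i j x]
        by (auto simp: abs_le_iff)
      then show "cmod (?g x $ i $ j) \<le> B + B"
        using cmod_le[of "?g x $ i $ j"] by simp
    qed
    finally show ?thesis .
  qed
  then have "bounded (range ?g)" by (auto simp: bounded_iff)
  moreover have "continuous_on UNIV ?g"
    unfolding Complex_eq by (intro continuous_intros u v)
  moreover have "?g x = f x" if "x \<in> S" for x
    using u(3)[OF that] v(3)[OF that] by (simp add: vec_eq_iff)
  ultimately show ?thesis using that by blast
qed

text \<open>The step from one stratum \<open>A\<close> to the next stratum \<open>A'\<close>, where the rank is constant on
  \<open>A' - A\<close>.  At points of \<open>A' - A\<close> the function \<open>p\<close> itself is continuous relative to \<open>A'\<close>, as \<open>A\<close> is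
  closed.  At \<open>x \<in> A\<close>, where \<open>p\<close> may jump, \<open>b x = p x b x\<close> and semicontinuity give
  \<open>(1 - p y) b x = (1 - p y) p x b x \<longlonglongrightarrow> 0\<close>.\<close>

lemma continuous_on_lsc_mult:
  assumes p: "p \<in> lsc_projections" and b: "continuous_on UNIV b" and A: "closed A"
    and fixA: "\<And>x. x \<in> A \<Longrightarrow> p x ** b x = b x"
    and rank: "\<And>x y. x \<in> A' - A \<Longrightarrow> y \<in> A' - A \<Longrightarrow> real_rank (p y) \<le> real_rank (p x)"
  shows "continuous_on A' (\<lambda>x. p x ** b x)"
  unfolding continuous_on_def
proof
  fix x assume x: "x \<in> A'"
  have blim: "(b \<longlongrightarrow> b x) (at x within A')"
    using b by (meson UNIV_I continuous_on_def continuous_on_subset subset_UNIV x)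
  show "((\<lambda>y. p y ** b y) \<longlongrightarrow> p x ** b x) (at x within A')"
  proof (cases "x \<in> A")
    case True
    have lim: "((\<lambda>y. (mat 1 - p y) ** p x) \<longlongrightarrow> 0) (at x within A')"
      by (rule tendsto_mono[of _ "nhds x"]) (use p in \<open>simp_all add: at_within_def lsc_projections_iff\<close>)
    have "bounded (range (\<lambda>y. mat 1 - p y))"
      using p by (intro bounded_projection_valued projection_complement) (auto simp: lsc_projections_iff)
    then obtain K where K: "\<And>y. norm (mat 1 - p y) \<le> K" by (auto simp: bounded_iff)
    have 1: "((\<lambda>y. (mat 1 - p y) ** (b y - b x)) \<longlongrightarrow> 0) (at x within A')"
    proof (rule Lim_null_comparison)
      show "((\<lambda>y. K * norm (b y - b x)) \<longlongrightarrow> 0) (at x within A')"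
        using blim by (intro tendsto_mult_right_zero tendsto_norm_zero) (simp add: LIM_zero)
      show "\<forall>\<^sub>F y in at x within A'. norm ((mat 1 - p y) ** (b y - b x)) \<le> K * norm (b y - b x)"
        using order_trans[OF norm_matrix_mult_le mult_right_mono[OF K norm_ge_zero]]
        by (intro always_eventually allI)
    qed
    have 2: "((\<lambda>y. ((mat 1 - p y) ** p x) ** b x) \<longlongrightarrow> 0) (at x within A')"
      using matrix_mult.tendsto[OF lim tendsto_const[of "b x"]] by simp
    have "((\<lambda>y. b y - ((mat 1 - p y) ** (b y - b x) + ((mat 1 - p y) ** p x) ** b x))
        \<longlongrightarrow> b x - (0 + 0)) (at x within A')"
      by (intro tendsto_intros 1 2 blim)
    moreover have "b y - ((mat 1 - p y) ** (b y - b x) + ((mat 1 - p y) ** p x) ** b x) = p y ** b y" for y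
    proof -
      have "((mat 1 - p y) ** p x) ** b x = (mat 1 - p y) ** b x"
        by (simp only: matrix_mul_assoc[symmetric] fixA[OF True])
      then have "(mat 1 - p y) ** (b y - b x) + ((mat 1 - p y) ** p x) ** b x = (mat 1 - p y) ** b y"
        by (simp only: matrix_mult.add_right[symmetric] diff_add_cancel)
      then show ?thesis by (simp only: matrix_mult.diff_left matrix_mul_lid) simp
    qed
    ultimately show ?thesis using fixA[OF True] by simp
  next
    case False
    then have "\<forall>\<^sub>F y in nhds x. y \<in> - A"
      using A by (intro eventually_nhds_in_open) auto
    then have "\<forall>\<^sub>F y in at x within A'. y \<in> A' - A"
      by (auto simp: eventually_at_filter elim: eventually_mono)
    then have "\<forall>\<^sub>F y in at x within A'. real_rank (p y) \<le> real_rank (p x)"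
      by eventually_elim (use rank False x in blast)
    from matrix_mult.tendsto[OF lsc_tendsto_of_rank_le[OF p this] blim] show ?thesis .
  qed
qed

text \<open>Points need not be closed.  In a regular space this does no harm: if an open neighbourhood of
  \<open>x\<close> missed \<open>z\<close>, then \<open>z\<close> would have a neighbourhood that misses \<open>x\<close>.\<close>

lemma regular_closure_singleton:
  fixes x z :: "'x::topological_space"
  assumes "regular_space (euclidean :: 'x topology)"
    and z: "z \<in> closure {x}" and ev: "\<forall>\<^sub>F y in nhds x. Q y"
  shows "Q z"
proof -
  obtain U where U: "open U" "x \<in> U" "\<And>y. y \<in> U \<Longrightarrow> Q y" using ev unfolding eventually_nhds by blast
  have "z \<in> U"
  proof (rule ccontr)
    assume "z \<notin> U"
    have "closedin euclidean (- U) \<and> x \<in> topspace euclidean - - U"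
      using U by (simp add: closed_Compl)
    from assms(1)[unfolded regular_space_def, rule_format, OF this]
    obtain V W where VW: "open V" "open W" "x \<in> V" "- U \<subseteq> W" "disjnt V W"
      unfolding open_openin[symmetric] by (elim exE conjE)
    have "z \<in> W" using VW \<open>z \<notin> U\<close> by auto
    then have "x \<in> W" using z VW(2) open_Int_closure_eq_empty[of W "{x}"] by auto
    then show False using VW by (auto simp: disjnt_def)
  qed
  then show ?thesis by (rule U)
qed

lemma lsc_closure_singleton:
  assumes "regular_space (euclidean :: 'x::topological_space topology)"
    and p: "p \<in> lsc_projections" and z: "(z::'x) \<in> closure {x}"
  shows "p z ** p x = p x"
proof -
  have "norm ((mat 1 - p z) ** p x) < e" if "0 < e" for e
  proof -
    have "((\<lambda>y. (mat 1 - p y) ** p x) \<longlongrightarrow> 0) (nhds x)" using p by (simp add: lsc_projections_iff)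
    from tendstoD[OF this that] have "\<forall>\<^sub>F y in nhds x. norm ((mat 1 - p y) ** p x) < e"
      by (simp add: dist_norm)
    then show ?thesis by (rule regular_closure_singleton[OF assms(1) z])
  qed
  then have "norm ((mat 1 - p z) ** p x) \<le> 0" by (meson not_le order_less_irrefl)
  then show ?thesis by (simp add: matrix_mult.diff_left)
qed

text \<open>The sets where the rank is less than \<open>j\<close> are closed, and the section is extended over one of
  them at a time: multiplication with \<open>p\<close> pushes the current function into the ranges of \<open>p\<close>, and
  Tietze's theorem extends the result from the stratum, where it is continuous, to the whole space.\<close>

lemma lsc_continuous_section:
  fixes p :: "'x::topological_space \<Rightarrow> complex^'n^'n"
  assumes normal: "normal_space (euclidean :: 'x topology)"
    and regular: "regular_space (euclidean :: 'x topology)"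
    and p: "p \<in> lsc_projections"
  obtains b where "b \<in> bcontfun" "\<And>y. p y ** b y = b y" "b x = p x"
proof -
  \<comment> \<open>The closure of the point carries the constant section that starts the induction.\<close>
  define A where "A j = closure {x} \<union> {y. real_rank (p y) < j}" for j
  have clA: "closed (A j)" for j
    unfolding A_def by (intro closed_Un closed_closure closed_lsc_rank_less p)
  have bddp: "bounded (range p)"
    using p by (intro bounded_projection_valued) (auto simp: lsc_projections_iff)
  have "\<exists>b. continuous_on UNIV b \<and> bounded (range b) \<and> b x = p x \<and> (\<forall>y\<in>A j. p y ** b y = b y)" for j
  proof (induction j)
    case 0
    show ?case
      by (rule exI[of _ "\<lambda>_. p x"]) (auto simp: A_def lsc_closure_singleton[OF regular p])
  next
    case (Suc j)
    then obtain b where b: "continuous_on UNIV b" "bounded (range b)" "b x = p x"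
      "\<And>y. y \<in> A j \<Longrightarrow> p y ** b y = b y" by blast
    have "continuous_on (A (Suc j)) (\<lambda>y. p y ** b y)"
      by (rule continuous_on_lsc_mult[OF p b(1) clA b(4)]) (auto simp: A_def)
    moreover have "bounded ((\<lambda>y. p y ** b y) ` A (Suc j))"
      by (rule bounded_matrix_product) (use bddp b(2) in \<open>auto intro: bounded_subset\<close>)
    ultimately obtain g where g: "continuous_on UNIV g" "bounded (range g)"
        "\<And>y. y \<in> A (Suc j) \<Longrightarrow> g y = p y ** b y"
      using Tietze_matrix[OF normal clA] by blast
    have "p y ** p y = p y" for y using p by (auto simp: lsc_projections_iff projection_matrices_def)
    then have "p y ** g y = g y" if "y \<in> A (Suc j)" for y
      using g(3)[OF that] by (simp add: matrix_mul_assoc)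
    moreover have "x \<in> A k" for k using closure_subset[of "{x}"] by (auto simp: A_def)
    then have "g x = p x" using g(3) b(3) b(4) by metis
    ultimately show ?case using g by blast
  qed
  \<comment> \<open>No rank exceeds the dimension, so this stratum is the whole space.\<close>
  from this[of "Suc DIM(complex^'n)"] obtain b where "continuous_on UNIV b" "bounded (range b)" "b x = p x"
      "\<And>y. y \<in> A (Suc DIM(complex^'n)) \<Longrightarrow> p y ** b y = b y" by blast
  moreover have "y \<in> A (Suc DIM(complex^'n))" for y
    using dim_subset_UNIV[of "range ((*v) (p y))"] by (simp add: A_def real_rank_def less_Suc_eq_le)
  ultimately show ?thesis using that by (simp add: bcontfun_def)
qed


section \<open>Suprema of bounded directed sets of matrices\<close>

lemma closed_positive_matrices: "closed (Collect positive_matrix)"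
  unfolding positive_matrix_def ctranspose_def matrix_vector_mult_def
  by (intro closed_Collect_conj closed_Collect_all closed_Collect_eq closed_Collect_le continuous_intros)

text \<open>Since the trace controls the norm of a positive matrix, elements whose trace is nearly maximal
  are close to everything above them; a sequence of such elements is Cauchy.\<close>

lemma directed_matrix_sup:
  fixes S :: "(complex^'n^'n) set"
  assumes "S \<noteq> {}"
    and directed: "\<And>M N. M \<in> S \<Longrightarrow> N \<in> S \<Longrightarrow> \<exists>K\<in>S. positive_matrix (K - M) \<and> positive_matrix (K - N)"
    and bound: "\<And>M. M \<in> S \<Longrightarrow> Re (trace M) \<le> c"
  obtains m where "\<And>M. M \<in> S \<Longrightarrow> positive_matrix (m - M)"
    and "\<And>e. 0 < e \<Longrightarrow> \<exists>M\<in>S. norm (m - M) < e"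
proof -
  let ?t = "\<lambda>M. Re (trace M)" and ?n = "real CARD('n)"
  define s where "s = Sup (?t ` S)"
  have bdd: "bdd_above (?t ` S)" by (rule bdd_aboveI2) (rule bound)
  have le_s: "?t M \<le> s" if "M \<in> S" for M
    unfolding s_def by (rule cSup_upper) (use that bdd in auto)
  have "\<exists>M\<in>S. s - 1 / Suc k < ?t M" for k
    using less_cSup_iff[of "?t ` S" "s - 1 / Suc k"] assms(1) bdd unfolding s_def by auto
  then obtain X where X: "\<And>k. X k \<in> S" "\<And>k. s - 1 / Suc k < ?t (X k)" by metis
  define e where "e k = ?n * (1 / Suc k)" for k
  have near: "norm (K - X k) \<le> e k" if "K \<in> S" "positive_matrix (K - X k)" for K k
  proof -
    have "norm (K - X k) \<le> ?n * ?t (K - X k)" by (rule norm_positive_le_trace[OF that(2)])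
    also have "\<dots> \<le> ?n * (1 / Suc k)"
      using le_s[OF that(1)] X(2)[of k] by (intro mult_left_mono) (simp_all add: trace_sub)
    finally show ?thesis unfolding e_def .
  qed
  have e0: "e \<longlonglongrightarrow> 0" unfolding e_def
    by (intro tendsto_mult_right_zero) (rule LIMSEQ_inverse_real_of_nat[unfolded inverse_eq_divide])
  have decr: "e k \<le> e N" if "N \<le> k" for N k
    unfolding e_def using that by (intro mult_left_mono frac_le) auto
  have dist: "norm (X k - X l) \<le> e k + e l" for k l
  proof -
    obtain K where K: "K \<in> S" "positive_matrix (K - X k)" "positive_matrix (K - X l)"
      using directed[OF X(1) X(1)] by blast
    have "norm (X k - X l) \<le> norm (K - X k) + norm (K - X l)"
      using norm_triangle_ineq4[of "K - X l" "K - X k"] by simp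
    then show ?thesis using near[OF K(1,2)] near[OF K(1,3)] by linarith
  qed
  have "Cauchy X"
  proof (rule CauchyI)
    fix \<epsilon> :: real assume "0 < \<epsilon>"
    then have "\<forall>\<^sub>F k in sequentially. e k < \<epsilon> / 2"
      using order_tendstoD(2)[OF e0, of "\<epsilon> / 2"] by simp
    then obtain N where N: "e N < \<epsilon> / 2" by (auto simp: eventually_sequentially)
    have "norm (X k - X l) < \<epsilon>" if "N \<le> k" "N \<le> l" for k l
      using dist[of k l] decr[OF that(1)] decr[OF that(2)] N by linarith
    then show "\<exists>N. \<forall>k\<ge>N. \<forall>l\<ge>N. norm (X k - X l) < \<epsilon>" by blast
  qed
  then obtain m where m: "X \<longlonglongrightarrow> m" using Cauchy_convergent_iff convergent_def by blast
  have "positive_matrix (m - M)" if M: "M \<in> S" for M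
  proof -
    have "\<exists>K\<in>S. positive_matrix (K - M) \<and> positive_matrix (K - X k)" for k
      using directed[OF M X(1)] .
    then obtain Y where Y: "\<And>k. Y k \<in> S" "\<And>k. positive_matrix (Y k - M)"
      "\<And>k. positive_matrix (Y k - X k)" by metis
    have "(\<lambda>k. Y k - X k) \<longlonglongrightarrow> 0"
      by (rule Lim_null_comparison[OF _ e0]) (use near Y in auto)
    from tendsto_add[OF this m] have lim: "(\<lambda>k. Y k - M) \<longlonglongrightarrow> m - M"
      by (intro tendsto_diff tendsto_const) simp
    have "m - M \<in> Collect positive_matrix"
      by (rule closed_sequentially[OF closed_positive_matrices _ lim]) (simp add: Y(2))
    then show ?thesis by simp
  qed
  moreover have "\<exists>M\<in>S. norm (m - M) < \<epsilon>" if "0 < \<epsilon>" for \<epsilon>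
    using LIMSEQ_D[OF m that] X(1) by (metis norm_minus_commute order_refl)
  ultimately show ?thesis using that by blast
qed


section \<open>The operator monotone transform \<open>M \<mapsto> M (1 + M)\<^sup>-\<^sup>1\<close>\<close>

abbreviation resolvent :: "complex^'n^'n \<Rightarrow> complex^'n^'n" where
  "resolvent M \<equiv> matrix_inv (mat 1 + M)"

text \<open>This is \<open>M (1 + M)\<^sup>-\<^sup>1\<close>.  It sends the positive matrices into the unit ball and preserves
  their order, so that it turns a family closed under addition into a directed family of
  contractions.\<close>

definition shrink :: "complex^'n^'n \<Rightarrow> complex^'n^'n" where
  "shrink M = mat 1 - resolvent M"

lemma resolvent_inverse:
  assumes "positive_matrix M"
  shows "(mat 1 + M) ** resolvent M = mat 1" "resolvent M ** (mat 1 + M) = mat 1"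
proof -
  have "v = 0" if "(mat 1 + M) *v v = 0" for v
  proof -
    have "inner v v + inner v (M *v v) = 0"
      using arg_cong[OF that, of "inner v"]
      by (simp add: matrix_vector_mult_add_rdistrib inner_add_right)
    moreover have "0 \<le> inner v (M *v v)" using assms by (simp add: positive_matrix_def)
    ultimately have "inner v v \<le> 0" by linarith
    then have "(norm v)\<^sup>2 \<le> 0" by (simp only: power2_norm_eq_inner)
    then show ?thesis by simp
  qed
  then have "invertible (mat 1 + M)"
    unfolding invertible_left_inverse matrix_left_invertible_ker by blast
  then have "(mat 1 + M) ** resolvent M = mat 1 \<and> resolvent M ** (mat 1 + M) = mat 1"
    unfolding invertible_def matrix_inv_def by (rule someI_ex)
  then show "(mat 1 + M) ** resolvent M = mat 1" "resolvent M ** (mat 1 + M) = mat 1" by simp_all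
qed

lemma resolvent_eqI: "positive_matrix M \<Longrightarrow> (mat 1 + M) ** N = mat 1 \<Longrightarrow> resolvent M = N"
proof -
  assume M: "positive_matrix M" and N: "(mat 1 + M) ** N = mat 1"
  have "resolvent M = resolvent M ** ((mat 1 + M) ** N)" by (simp only: N matrix_mul_rid)
  also have "\<dots> = N" by (simp only: matrix_mul_assoc resolvent_inverse(2)[OF M] matrix_mul_lid)
  finally show ?thesis .
qed

lemma resolvent_apply:
  assumes "positive_matrix M"
  shows "resolvent M *v v + M *v (resolvent M *v v) = v"
proof -
  have "(mat 1 + M) *v (resolvent M *v v) = v"
    by (simp only: matrix_vector_mul_assoc resolvent_inverse(1)[OF assms] matrix_vector_mul_lid)
  then show ?thesis by (simp only: matrix_vector_mult_add_rdistrib matrix_vector_mul_lid)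
qed

lemma positive_resolvent:
  assumes "positive_matrix M" shows "positive_matrix (resolvent M)"
proof -
  have herm: "ctranspose M = M" using assms by (simp add: positive_matrix_def)
  have "(mat 1 + M) ** ctranspose (resolvent M) = mat 1"
    using arg_cong[OF resolvent_inverse(2)[OF assms], of ctranspose] herm
    by (simp add: ctranspose_algebra)
  then have "ctranspose (resolvent M) = resolvent M" by (rule resolvent_eqI[OF assms, symmetric])
  moreover have "0 \<le> inner v (resolvent M *v v)" for v
  proof -
    let ?u = "resolvent M *v v"
    have "inner v ?u = inner (?u + M *v ?u) ?u" by (simp only: resolvent_apply[OF assms])
    then have "inner v ?u = inner ?u ?u + inner ?u (M *v ?u)"
      by (simp only: inner_add_left inner_commute[of "M *v ?u"])
    then show ?thesis using assms by (simp add: positive_matrix_def)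
  qed
  ultimately show ?thesis by (simp add: positive_matrix_def)
qed

text \<open>With \<open>u = (1 + A)\<^sup>-\<^sup>1 v\<close> and \<open>w = (1 + B)\<^sup>-\<^sup>1 v\<close>, the form of \<open>1 + A\<close> at \<open>w - u\<close> is
  nonnegative, and it is at most \<open>\<langle>v, u\<rangle> - \<langle>v, w\<rangle>\<close> because \<open>A \<le> B\<close>.\<close>

lemma resolvent_antimono:
  assumes A: "positive_matrix A" and AB: "positive_matrix (B - A)"
  shows "positive_matrix (resolvent A - resolvent B)"
proof -
  have B: "positive_matrix B" using positive_matrix_add[OF A AB] by simp
  have "inner v (resolvent B *v v) \<le> inner v (resolvent A *v v)" for v
  proof -
    define u where "u = resolvent A *v v"
    define w where "w = resolvent B *v v"
    have u: "u + A *v u = v" and w: "w + B *v w = v"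
      unfolding u_def w_def by (rule resolvent_apply[OF A], rule resolvent_apply[OF B])
    have "0 \<le> inner (w - u) (A *v (w - u))" using A by (simp add: positive_matrix_def)
    then have "0 \<le> inner (w - u) (w - u) + inner (w - u) (A *v (w - u))" by simp
    also have "\<dots> = inner (w - u) ((w + A *v w) - (u + A *v u))"
      by (simp add: matrix_vector_mult_diff_distrib inner_add_right inner_diff_right)
    also have "\<dots> = inner w w + inner w (A *v w) - inner v w - (inner u (w + A *v w) - inner u v)"
      unfolding u by (simp add: inner_simps inner_commute)
    also have "inner u (w + A *v w) = inner v w"
    proof -
      have "inner u (A *v w) = inner (A *v u) w" using A by (simp add: inner_matrix_left positive_matrix_def)
      then show ?thesis unfolding u[symmetric] by (simp add: inner_simps)
    qed
    also have "inner w (A *v w) \<le> inner w (B *v w)"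
      using AB by (simp add: positive_matrix_def matrix_vector_mult_diff_rdistrib inner_diff_right)
    finally have "0 \<le> inner w (w + B *v w) - inner v w - (inner v w - inner u v)"
      by (simp add: inner_add_right)
    then show ?thesis unfolding w by (simp add: u_def w_def inner_commute)
  qed
  then show ?thesis
    using positive_resolvent[OF A] positive_resolvent[OF B]
    by (simp add: positive_matrix_def ctranspose_algebra matrix_vector_mult_diff_rdistrib inner_diff_right)
qed

lemma shrink_mono:
  "positive_matrix A \<Longrightarrow> positive_matrix (B - A) \<Longrightarrow> positive_matrix (shrink B - shrink A)"
  using resolvent_antimono by (simp add: shrink_def)

lemma positive_shrink:
  assumes "positive_matrix M" shows "positive_matrix (shrink M)"
proof -
  have 0: "positive_matrix 0" by (simp add: positive_matrix_def ctranspose_algebra)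
  have "resolvent 0 = (mat 1 :: complex^'a^'a)" by (rule resolvent_eqI[OF 0]) simp
  then show ?thesis using shrink_mono[OF 0, of M] assms by (simp add: shrink_def)
qed

lemma positive_one_minus_shrink: "positive_matrix M \<Longrightarrow> positive_matrix (mat 1 - shrink M)"
  by (simp add: shrink_def positive_resolvent)

lemma shrink_range:
  assumes M: "positive_matrix M" and PM: "P ** M = M"
  shows "P ** shrink M = shrink M"
proof -
  have "shrink M = M ** resolvent M"
    using resolvent_inverse(1)[OF M] by (simp add: shrink_def matrix_mult.add_left algebra_simps)
  then show ?thesis using PM by (simp add: matrix_mul_assoc)
qed

lemma shrink_scaled_projection:
  assumes P: "P \<in> projection_matrices" and c: "0 \<le> c"
  shows "shrink (c *\<^sub>R P) = (c / (1 + c)) *\<^sub>R P"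
proof -
  have PP: "P ** P = P" using P by (simp add: projection_matrices_def)
  let ?d = "c / (1 + c)"
  have d: "c - ?d - c * ?d = 0" using c by (simp add: field_simps)
  have "(mat 1 + c *\<^sub>R P) ** (mat 1 - ?d *\<^sub>R P) = mat 1 + (c - ?d - c * ?d) *\<^sub>R P"
    by (simp add: matrix_mult.add_left matrix_mult.diff_right matrix_mult.scaleR_left
        matrix_mult.scaleR_right PP algebra_simps)
  then have "resolvent (c *\<^sub>R P) = mat 1 - ?d *\<^sub>R P"
    unfolding d using resolvent_eqI[OF positive_matrix_scaleR[OF c projection_positive[OF P]]] by simp
  then show ?thesis by (simp add: shrink_def)
qed

lemma norm_shrink_le: "positive_matrix M \<Longrightarrow> norm (shrink M) \<le> real CARD('n) * real CARD('n)"
  for M :: "complex^'n^'n"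
  by (intro norm_positive_contraction_le positive_shrink positive_one_minus_shrink)

text \<open>By the resolvent identity
  \<open>(1 + B)\<^sup>-\<^sup>1 - (1 + A)\<^sup>-\<^sup>1 = (1 + B)\<^sup>-\<^sup>1 (A - B) (1 + A)\<^sup>-\<^sup>1\<close>.\<close>

lemma norm_shrink_diff_le:
  fixes A B :: "complex^'n^'n"
  assumes A: "positive_matrix A" and B: "positive_matrix B"
  shows "norm (shrink A - shrink B) \<le> (real CARD('n) * real CARD('n))\<^sup>2 * norm (A - B)"
proof -
  let ?N = "real CARD('n) * real CARD('n)"
  have R: "norm (resolvent M) \<le> ?N" if "positive_matrix M" for M :: "complex^'n^'n"
    using norm_positive_contraction_le[OF positive_resolvent[OF that]] positive_shrink[OF that]
    by (simp add: shrink_def)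
  have "resolvent B ** (A - B) ** resolvent A
      = resolvent B ** ((mat 1 + A) ** resolvent A) - (resolvent B ** (mat 1 + B)) ** resolvent A"
    by (simp add: matrix_mult.diff_left matrix_mult.diff_right matrix_mult.add_left
        matrix_mult.add_right matrix_mul_assoc)
  also have "\<dots> = shrink A - shrink B"
    by (simp add: resolvent_inverse A B shrink_def)
  finally have "norm (shrink A - shrink B) = norm (resolvent B ** (A - B) ** resolvent A)" by simp
  also have "\<dots> \<le> norm (resolvent B) * norm (A - B) * norm (resolvent A)"
    by (rule order_trans[OF norm_matrix_mult_le mult_right_mono[OF norm_matrix_mult_le norm_ge_zero]])
  also have "\<dots> \<le> ?N * norm (A - B) * ?N"
    by (intro mult_mono R A B) auto
  finally show ?thesis by (simp add: power2_eq_square mult_ac)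
qed

lemma shrink_bcontfun:
  fixes a :: "'x::topological_space \<Rightarrow> complex^'n^'n"
  assumes "a \<in> bcontfun" and pos: "\<And>x. positive_matrix (a x)"
  shows "(\<lambda>x. shrink (a x)) \<in> bcontfun"
proof -
  have "continuous_on UNIV (\<lambda>x. shrink (a x))"
    unfolding continuous_on_def
  proof
    fix x
    have "(a \<longlongrightarrow> a x) (at x)" using assms(1) by (auto simp: bcontfun_def continuous_on_def)
    then have "((\<lambda>y. (real CARD('n) * real CARD('n))\<^sup>2 * norm (a y - a x)) \<longlongrightarrow> 0) (at x)"
      by (intro tendsto_mult_right_zero tendsto_norm_zero) (simp add: LIM_zero)
    then have "((\<lambda>y. shrink (a y) - shrink (a x)) \<longlongrightarrow> 0) (at x)"
      by (rule Lim_null_comparison[rotated]) (intro always_eventually allI norm_shrink_diff_le pos)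
    then show "((\<lambda>x. shrink (a x)) \<longlongrightarrow> shrink (a x)) (at x)" by (simp add: LIM_zero_iff)
  qed
  moreover have "bounded (range (\<lambda>x. shrink (a x)))"
    using norm_shrink_le[OF pos] by (auto simp: bounded_iff)
  ultimately show ?thesis by (simp add: bcontfun_def)
qed


section \<open>Multiplication operators\<close>

definition single :: "'x \<Rightarrow> complex^'n \<Rightarrow> ('x, 'n::finite) l2_sum" where
  "single x w = Abs_l2 (\<lambda>y. if y = x then w else 0)"

lemma l2_fun_single: "l2_fun (single x w) y = (if y = x then w else 0)"
proof -
  have "(\<lambda>y. (norm (if y = x then w else 0))\<^sup>2) summable_on UNIV"
    by (rule finite_nonzero_values_imp_summable_on) (rule finite_subset[of _ "{x}"], auto)
  then show ?thesis unfolding single_def by (simp add: Abs_l2_inverse)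
qed

lemma inner_single: "inner (single x w) v = inner w (l2_fun v x)"
proof -
  have "inner (single x w) v = (\<Sum>\<^sub>\<infinity>y\<in>{x}. inner (l2_fun (single x w) y) (l2_fun v y))"
    unfolding inner_l2_sum_def by (rule infsum_cong_neutral) (auto simp: l2_fun_single)
  then show ?thesis by (simp add: l2_fun_single)
qed

lemma mult_op_single: "bounded (range f) \<Longrightarrow> mult_op f (single x w) = single x (f x *v w)"
  by (simp add: l2_fun_inject[symmetric] fun_eq_iff mult_op_apply l2_fun_single)

lemma inner_mult_op:
  "bounded (range f) \<Longrightarrow> inner v (mult_op f v) = (\<Sum>\<^sub>\<infinity>x. inner (l2_fun v x) (f x *v l2_fun v x))"
  by (simp add: inner_l2_sum_def mult_op_apply)

lemma mult_op_form_summable: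
  "bounded (range f) \<Longrightarrow> (\<lambda>x. inner (l2_fun v x) (f x *v l2_fun v x)) summable_on UNIV"
  using l2_inner_summable[of v "mult_op f v"] by (simp add: mult_op_apply)

lemma mult_op_diff:
  assumes "bounded (range f)" "bounded (range g)"
  shows "mult_op (\<lambda>x. f x - g x) = mult_op f - mult_op g"
proof -
  have "bounded (range (\<lambda>x. f x - g x))"
    using bounded_minus_comp[OF assms] .
  then show ?thesis
    by (intro blinfun_eqI) (simp add: l2_fun_inject[symmetric] fun_eq_iff mult_op_apply assms
        blinfun.diff_left l2_fun_simps matrix_vector_mult_diff_rdistrib)
qed

lemma mult_op_one: "mult_op (\<lambda>_. mat 1) = id_blinfun"
  by (intro blinfun_eqI) (simp add: l2_fun_inject[symmetric] fun_eq_iff mult_op_apply)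

lemma mult_op_compose:
  assumes "bounded (range f)" "bounded (range g)"
  shows "mult_op f o\<^sub>L mult_op g = mult_op (\<lambda>x. f x ** g x)"
  using bounded_matrix_product[OF assms]
  by (intro blinfun_eqI) (simp add: l2_fun_inject[symmetric] fun_eq_iff mult_op_apply assms
      matrix_vector_mul_assoc)

lemma selfadjoint_inner:
  "selfadjoint T \<Longrightarrow> inner (blinfun_apply T u) v = inner u (blinfun_apply T v)"
  by (simp add: selfadjoint_def flip: Re_cinner)

lemma selfadjoint_mult_op:
  fixes f :: "'x \<Rightarrow> complex^'n^'n"
  assumes "bounded (range f)"
  shows "selfadjoint (mult_op f) \<longleftrightarrow> (\<forall>x. ctranspose (f x) = f x)"
proof
  assume T: "selfadjoint (mult_op f)"
  show "\<forall>x. ctranspose (f x) = f x"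
  proof
    fix x
    have "inner u (ctranspose (f x) *v v) = inner u (f x *v v)" for u v
      using selfadjoint_inner[OF T, of "single x u" "single x v"]
      by (simp add: mult_op_single assms inner_single l2_fun_single inner_matrix_left)
    then have "ctranspose (f x) *v v = f x *v v" for v using vector_eq_ldot by blast
    then show "ctranspose (f x) = f x" by (simp add: matrix_eq)
  qed
next
  assume "\<forall>x. ctranspose (f x) = f x"
  then show "selfadjoint (mult_op f)"
    using mult_op_bounded_ops[OF assms]
    by (simp add: selfadjoint_def cinner_l2_sum_def mult_op_apply assms cdot_matrix_left)
qed

lemma positive_mult_op:
  fixes f :: "'x \<Rightarrow> complex^'n^'n"
  assumes "bounded (range f)"
  shows "positive_op (mult_op f) \<longleftrightarrow> (\<forall>x. positive_matrix (f x))"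
proof
  assume T: "positive_op (mult_op f)"
  have "0 \<le> inner w (f x *v w)" for x w
  proof -
    have "0 \<le> inner (single x w) (mult_op f (single x w))"
      using T by (simp add: positive_op_def Re_cinner)
    then show ?thesis by (simp add: mult_op_single assms inner_single l2_fun_single)
  qed
  then show "\<forall>x. positive_matrix (f x)"
    using T by (simp add: positive_matrix_def positive_op_def selfadjoint_mult_op assms)
next
  assume "\<forall>x. positive_matrix (f x)"
  then show "positive_op (mult_op f)"
    by (simp add: positive_matrix_def positive_op_def selfadjoint_mult_op assms Re_cinner
        inner_mult_op infsum_nonneg)
qed

lemma op_le_mult_op:
  assumes "bounded (range f)" "bounded (range g)"
  shows "op_le (mult_op f) (mult_op g) \<longleftrightarrow> (\<forall>x. positive_matrix (g x - f x))"
  using positive_mult_op[OF bounded_minus_comp[OF assms(2,1)]] mult_op_diff[OF assms(2,1)]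
  by (simp add: op_le_def)

lemma projection_mult_op:
  fixes q :: "'x \<Rightarrow> complex^'n^'n"
  assumes "bounded (range q)"
  shows "projection_op (mult_op q) \<longleftrightarrow> (\<forall>x. q x \<in> projection_matrices)"
proof -
  have "mult_op (\<lambda>x. q x ** q x) = mult_op q \<longleftrightarrow> (\<lambda>x. q x ** q x) = q"
    using inj_on_eq_iff[OF inj_on_mult_op] bounded_matrix_product[OF assms assms] assms by blast
  then show ?thesis
    by (auto simp: projection_op_def projection_matrices_def selfadjoint_mult_op mult_op_compose
        assms fun_eq_iff)
qed

lemma norm_mult_op_le_1:
  assumes bdd: "bounded (range f)" and f: "\<And>x v. norm (f x *v v) \<le> norm v"
  shows "norm (mult_op f) \<le> 1"
proof (rule norm_blinfun_bound)
  fix v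
  have "(norm (mult_op f v))\<^sup>2 \<le> (norm v)\<^sup>2"
    unfolding l2_norm_sq
    by (intro infsum_mono l2_fun_summable) (simp add: mult_op_apply bdd f power_mono)
  then have "norm (mult_op f v) \<le> norm v" by (rule power2_le_imp_le) simp
  then show "norm (mult_op f v) \<le> 1 * norm v" by simp
qed simp


section \<open>Open projections and suprema of multiplication operators\<close>

lemma selfadjoint_diff:
  assumes "selfadjoint S" "selfadjoint T" shows "selfadjoint (S - T)"
proof -
  have diff_right: "cinner u (v - w) = cinner u v - cinner u w" for u v w :: 'a
    using cinner_add_right[of u "v - w" w] by simp
  have diff_left: "cinner (u - v) w = cinner u w - cinner v w" for u v w :: 'a
    by (metis cinner_commute complex_cnj_diff diff_right)
  have scale: "c *\<^sub>C (u - v) = c *\<^sub>C u - c *\<^sub>C v" for c and u v :: 'a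
    using scaleC_add_right[of c "u - v" v] by simp
  show ?thesis
    using assms by (simp add: selfadjoint_def bounded_ops_def blinfun.diff_left diff_left diff_right scale)
qed

lemma op_le_iff:
  assumes "selfadjoint S" "selfadjoint T"
  shows "op_le S T \<longleftrightarrow> (\<forall>v. inner v (blinfun_apply S v) \<le> inner v (blinfun_apply T v))"
  using selfadjoint_diff[OF assms(2,1)]
  by (simp add: op_le_def positive_op_def Re_cinner blinfun.diff_left inner_diff_right)

lemma op_le_antisym:
  assumes S: "selfadjoint S" and T: "selfadjoint T" and "op_le S T" "op_le T S"
  shows "S = T"
proof -
  have form: "inner v (blinfun_apply S v) = inner v (blinfun_apply T v)" for v
    using assms(3,4) unfolding op_le_iff[OF S T] op_le_iff[OF T S] by (blast intro: antisym)
  have "inner u (blinfun_apply S v) = inner u (blinfun_apply T v)" for u v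
    using form[of "u + v"] form[of u] form[of v] selfadjoint_inner[OF S, of v u] selfadjoint_inner[OF T, of v u]
    by (simp add: blinfun.add_right inner_add_left inner_add_right inner_commute)
  then show ?thesis using vector_eq_ldot by (intro blinfun_eqI) blast
qed

lemma is_op_sup_unique: "is_op_sup D s \<Longrightarrow> is_op_sup D t \<Longrightarrow> s = t"
  unfolding is_op_sup_def by (blast intro: op_le_antisym)

text \<open>The range of a net may replace the net, which leaves directed sets of operators.\<close>

lemma open_projections_iff:
  "p \<in> open_projections A \<longleftrightarrow> projection_op p \<and>
     (\<exists>D\<subseteq>A. D \<noteq> {} \<and> (\<forall>a\<in>D. positive_op a \<and> norm a \<le> 1) \<and>
        (\<forall>a\<in>D. \<forall>b\<in>D. \<exists>c\<in>D. op_le a c \<and> op_le b c) \<and> is_op_sup D p)"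
  (is "_ \<longleftrightarrow> _ \<and> ?R")
proof (intro iffI conjI)
  assume "p \<in> open_projections A"
  then obtain I :: "('a \<Rightarrow>\<^sub>L 'a) set" and le a where proj: "projection_op p"
    and net: "increasing_net I le a"
    and a: "\<forall>i\<in>I. a i \<in> A \<and> positive_op (a i) \<and> norm (a i) \<le> 1" and sup: "is_op_sup (a ` I) p"
    unfolding open_projections_def by blast
  show "projection_op p" by (rule proj)
  have "I \<noteq> {}" and dir: "\<forall>i\<in>I. \<forall>j\<in>I. \<exists>k\<in>I. le i k \<and> le j k"
    and mono: "\<forall>i\<in>I. \<forall>j\<in>I. le i j \<longrightarrow> op_le (a i) (a j)"
  proof -
    note net' = net[unfolded increasing_net_def directed_preorder_def]
    show "I \<noteq> {}" by (rule net'[THEN conjunct1, THEN conjunct1])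
    show "\<forall>i\<in>I. \<forall>j\<in>I. \<exists>k\<in>I. le i k \<and> le j k"
      by (rule net'[THEN conjunct1, THEN conjunct2, THEN conjunct2, THEN conjunct2])
    show "\<forall>i\<in>I. \<forall>j\<in>I. le i j \<longrightarrow> op_le (a i) (a j)" by (rule net'[THEN conjunct2])
  qed
  note \<open>I \<noteq> {}\<close>
  moreover have "\<exists>k\<in>I. op_le (a i) (a k) \<and> op_le (a j) (a k)" if ij: "i \<in> I" "j \<in> I" for i j
  proof -
    obtain k where k: "k \<in> I" "le i k" "le j k" using dir ij by meson
    then have "op_le (a i) (a k)" "op_le (a j) (a k)" using mono ij by simp_all
    then show ?thesis using k(1) by blast
  qed
  ultimately show ?R by (intro exI[of _ "a ` I"]) (use a sup in auto)
next
  assume "projection_op p \<and> ?R"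
  then obtain D where proj: "projection_op p" and D: "D \<subseteq> A" "D \<noteq> {}"
    "\<forall>a\<in>D. positive_op a \<and> norm a \<le> 1" "\<forall>a\<in>D. \<forall>b\<in>D. \<exists>c\<in>D. op_le a c \<and> op_le b c"
    "is_op_sup D p" by blast
  have sa: "selfadjoint a" if "a \<in> D" for a using D(3) that by (simp add: positive_op_def)
  have "directed_preorder D op_le"
    unfolding directed_preorder_def
  proof (intro conjI ballI impI)
    show "op_le a a" if "a \<in> D" for a using op_le_iff[OF sa sa] that by simp
    show "op_le a c" if "a \<in> D" "b \<in> D" "c \<in> D" "op_le a b" "op_le b c" for a b c
      using that op_le_iff[OF sa sa] by (meson order_trans)
  qed (use D in auto)
  then have "increasing_net D op_le (\<lambda>a. a)" by (simp add: increasing_net_def)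
  moreover have "is_op_sup ((\<lambda>a. a) ` D) p" using D(5) by simp
  ultimately show "p \<in> open_projections A"
    unfolding open_projections_def using proj D(1,3) by blast
qed

text \<open>A pointwise supremum is a supremum among all self-adjoint operators, including those that are
  not multiplication operators.  Only finitely many coordinates matter up to \<open>e\<close>, because all forms lie between \<open>0\<close> and that of
  \<open>q\<close>; and on finitely many coordinates directedness makes the approximation simultaneous.\<close>

lemma is_op_sup_mult_op:
  fixes q :: "'x \<Rightarrow> complex^'n^'n"
  assumes ne: "F \<noteq> {}" and bdd: "\<And>f. f \<in> F \<Longrightarrow> bounded (range f)"
    and pos: "\<And>f x. f \<in> F \<Longrightarrow> positive_matrix (f x)"
    and directed: "\<And>f g. f \<in> F \<Longrightarrow> g \<in> F \<Longrightarrow>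
      \<exists>h\<in>F. \<forall>x. positive_matrix (h x - f x) \<and> positive_matrix (h x - g x)"
    and q: "bounded (range q)" and upper: "\<And>f x. f \<in> F \<Longrightarrow> positive_matrix (q x - f x)"
    and approx: "\<And>x e. 0 < e \<Longrightarrow> \<exists>f\<in>F. norm (q x - f x) < e"
  shows "is_op_sup (mult_op ` F) (mult_op q)"
proof -
  obtain f0 where f0: "f0 \<in> F" using ne by blast
  have posq: "positive_matrix (q x)" for x
    using positive_matrix_add[OF upper[OF f0] pos[OF f0], of x x] by simp
  then have sq: "selfadjoint (mult_op q)" using selfadjoint_mult_op[OF q] by (simp add: positive_matrix_def)
  have sf: "selfadjoint (mult_op f)" if "f \<in> F" for f
    using selfadjoint_mult_op[OF bdd[OF that]] pos[OF that] by (simp add: positive_matrix_def)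
  have "inner v (mult_op q v) \<le> inner v (blinfun_apply t v)"
    if t: "\<And>f. f \<in> F \<Longrightarrow> inner v (mult_op f v) \<le> inner v (blinfun_apply t v)" for t v
  proof (rule field_le_epsilon)
    fix e :: real assume e: "0 < e"
    define G where "G f x = inner (l2_fun v x) (f x *v l2_fun v x)" for f :: "'x \<Rightarrow> complex^'n^'n" and x
    have G_mono: "G f x \<le> G g x" if "positive_matrix (g x - f x)" for f g x
      using that by (simp add: G_def positive_matrix_def matrix_vector_mult_diff_rdistrib inner_diff_right)
    obtain K where K: "finite K" "dist (sum (G q) K) (infsum (G q) UNIV) \<le> e / 2"
      using infsum_finite_approximation[OF mult_op_form_summable[OF q, of v], of "e / 2"] e
      unfolding G_def by auto
    define d where "d = e / 2 / (card K + 1)"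
    have d: "0 < d" using e by (simp add: d_def)
    have one: "\<exists>f\<in>F. G q x - d \<le> G f x" for x
    proof -
      let ?w = "l2_fun v x"
      let ?c = "(norm ?w)\<^sup>2 + 1"
      have c: "0 < ?c" by (simp add: add_nonneg_pos)
      obtain f where f: "f \<in> F" "norm (q x - f x) < d / ?c" using approx[of "d / ?c" x] c d by auto
      have "G q x - G f x = inner ?w ((q x - f x) *v ?w)"
        by (simp add: G_def matrix_vector_mult_diff_rdistrib inner_diff_right)
      also have "\<dots> \<le> norm ?w * (norm (q x - f x) * norm ?w)"
        by (rule order_trans[OF norm_cauchy_schwarz mult_left_mono[OF norm_matrix_vector_mult_le norm_ge_zero]])
      also have "\<dots> = norm (q x - f x) * (norm ?w)\<^sup>2" by (simp add: power2_eq_square)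
      also have "\<dots> \<le> d / ?c * ?c" using f(2) c d by (intro mult_mono) auto
      also have "\<dots> = d" using c by simp
      finally show ?thesis using f(1) by (intro bexI[of _ f]) auto
    qed
    have "\<exists>f\<in>F. \<forall>x\<in>K. G q x - d \<le> G f x"
      using K(1)
    proof (induction K)
      case empty then show ?case using f0 by blast
    next
      case (insert y K)
      then obtain f where f: "f \<in> F" "\<forall>x\<in>K. G q x - d \<le> G f x" by blast
      obtain g where g: "g \<in> F" "G q y - d \<le> G g y" using one by blast
      obtain h where h: "h \<in> F" "\<forall>x. positive_matrix (h x - f x) \<and> positive_matrix (h x - g x)"
        using directed[OF f(1) g(1)] by blast
      have mono: "G f x \<le> G h x" "G g x \<le> G h x" for x using h(2) by (auto intro: G_mono)
      have "G q x - d \<le> G h x" if "x \<in> insert y K" for x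
      proof (cases "x = y")
        case True
        then show ?thesis using g(2) mono(2)[of y] unfolding True by linarith
      next
        case False
        then have "G q x - d \<le> G f x" using f(2) that by blast
        then show ?thesis using mono(1)[of x] by linarith
      qed
      then show ?case using h(1) by blast
    qed
    then obtain f where f: "f \<in> F" "\<And>x. x \<in> K \<Longrightarrow> G q x - d \<le> G f x" by blast
    have "inner v (mult_op q v) = infsum (G q) UNIV"
      unfolding inner_mult_op[OF q] by (rule infsum_cong) (simp add: G_def)
    also have "\<dots> \<le> sum (G q) K + e / 2" using K(2) unfolding dist_real_def by linarith
    also have "sum (G q) K \<le> sum (G f) K + card K * d"
      using sum_mono[of K "\<lambda>x. G q x - d" "G f"] f(2) by (simp add: sum_subtractf)
    also have "card K * d \<le> e / 2" unfolding d_def using e by (simp add: field_simps)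
    also have "sum (G f) K \<le> inner v (mult_op f v)"
      unfolding inner_mult_op[OF bdd[OF f(1)]] G_def
      by (rule finite_sum_le_infsum[OF mult_op_form_summable[OF bdd[OF f(1)]]])
        (use K(1) pos[OF f(1)] in \<open>auto simp: positive_matrix_def\<close>)
    also have "\<dots> \<le> inner v (blinfun_apply t v)" by (rule t[OF f(1)])
    finally show "inner v (mult_op q v) \<le> inner v (blinfun_apply t v) + e" by simp
  qed
  then show ?thesis
    unfolding is_op_sup_def using sq sf upper op_le_mult_op[OF bdd q] by (auto simp: op_le_iff)
qed


section \<open>Open projections are the lower semicontinuous functions\<close>

text \<open>The pointwise supremum \<open>m\<close> of the net satisfies \<open>(1 - m y) f y = 0\<close> for each \<open>f\<close> in it, so
  that \<open>(1 - m y) m x = (1 - m y) (m x - f y)\<close>; this is small near \<open>x\<close> once \<open>f x\<close> is close to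
  \<open>m x\<close>.\<close>

lemma open_projection_imp_lsc:
  fixes p :: "('x::topological_space, 'n::finite) l2_sum \<Rightarrow>\<^sub>L ('x, 'n) l2_sum"
  assumes "p \<in> open_projections (mult_op ` bcontfun)"
  shows "p \<in> mult_op ` lsc_projections"
proof -
  obtain D where proj: "projection_op p" and "D \<subseteq> mult_op ` bcontfun" "D \<noteq> {}"
    "\<forall>a\<in>D. positive_op a \<and> norm a \<le> 1"
    "\<forall>a\<in>D. \<forall>b\<in>D. \<exists>c\<in>D. op_le a c \<and> op_le b c" and sup: "is_op_sup D p"
    using assms unfolding open_projections_iff by blast
  then have D: "D \<subseteq> mult_op ` bcontfun" "D \<noteq> {}"
    "\<And>a. a \<in> D \<Longrightarrow> positive_op a" "\<And>a. a \<in> D \<Longrightarrow> norm a \<le> 1"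
    "\<And>a b. a \<in> D \<Longrightarrow> b \<in> D \<Longrightarrow> \<exists>c\<in>D. op_le a c \<and> op_le b c"
    by simp_all
  define F where "F = {f \<in> bcontfun. mult_op f \<in> D}"
  have DF: "D = mult_op ` F" using D(1) by (auto simp: F_def)
  have bdd: "bounded (range f)" and cont: "continuous_on UNIV f" if "f \<in> F" for f
    using that by (auto simp: F_def bcontfun_def)
  have pos: "positive_matrix (f x)" if "f \<in> F" for f x
    using D(3)[of "mult_op f"] that positive_mult_op[OF bdd[OF that]] by (simp add: F_def)
  have directed: "\<exists>h\<in>F. \<forall>x. positive_matrix (h x - f x) \<and> positive_matrix (h x - g x)"
    if fg: "f \<in> F" "g \<in> F" for f g
  proof -
    obtain c where c: "c \<in> D" "op_le (mult_op f) c" "op_le (mult_op g) c"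
      using D(5)[of "mult_op f" "mult_op g"] fg by (auto simp: F_def)
    then obtain h where h: "h \<in> F" "c = mult_op h" unfolding DF by blast
    then show ?thesis
      using c op_le_mult_op[OF bdd bdd] fg by blast
  qed
  have le1: "positive_matrix (mat 1 - f x)" if f: "f \<in> F" for f x
  proof -
    have "inner w (f x *v w) \<le> inner w w" for w
    proof -
      have w: "norm (single x w) = norm w"
        by (simp add: norm_eq_sqrt_inner inner_single l2_fun_single)
      have "inner w (f x *v w) = inner (single x w) (mult_op f (single x w))"
        by (simp add: mult_op_single bdd[OF f] inner_single l2_fun_single)
      also have "\<dots> \<le> norm w * norm (mult_op f (single x w))"
        using norm_cauchy_schwarz[of "single x w"] by (simp add: w)
      also have "\<dots> \<le> norm w * (norm (mult_op f) * norm w)"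
        using norm_blinfun[of "mult_op f" "single x w"] by (intro mult_left_mono) (simp_all add: w)
      also have "\<dots> \<le> norm w * (1 * norm w)"
        using D(4)[of "mult_op f"] f by (intro mult_left_mono mult_right_mono) (auto simp: F_def)
      finally show ?thesis by (simp add: power2_norm_eq_inner[symmetric] power2_eq_square)
    qed
    then show ?thesis
      using pos[OF f] by (simp add: positive_matrix_def ctranspose_algebra
          matrix_vector_mult_diff_rdistrib inner_diff_right)
  qed
  have "\<exists>m. (\<forall>f\<in>F. positive_matrix (m - f x)) \<and> (\<forall>e>0. \<exists>f\<in>F. norm (m - f x) < e)" for x
  proof -
    let ?S = "(\<lambda>f. f x) ` F"
    have "Re (trace (f x)) \<le> real CARD('n) * (real CARD('n) * real CARD('n))" if "f \<in> F" for f
    proof -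
      have "Re (trace (f x)) \<le> (\<Sum>i\<in>(UNIV :: 'n set). norm (f x))"
        unfolding trace_def Re_sum
        by (intro sum_mono order_trans[OF complex_Re_le_cmod]
            order_trans[OF Finite_Cartesian_Product.norm_nth_le] order_refl
            Finite_Cartesian_Product.norm_nth_le)
      also have "\<dots> \<le> (\<Sum>i\<in>(UNIV :: 'n set). real CARD('n) * real CARD('n))"
        by (intro sum_mono norm_positive_contraction_le pos le1 that)
      finally show ?thesis by simp
    qed
    then have bound: "\<And>M. M \<in> ?S \<Longrightarrow> Re (trace M) \<le> real CARD('n) * (real CARD('n) * real CARD('n))"
      by blast
    have "?S \<noteq> {}" using D(2) DF by blast
    moreover have "\<exists>K\<in>?S. positive_matrix (K - M) \<and> positive_matrix (K - N)"
      if "M \<in> ?S" "N \<in> ?S" for M N using that directed by fast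
    ultimately obtain m where "\<And>M. M \<in> ?S \<Longrightarrow> positive_matrix (m - M)"
      and "\<And>e. 0 < e \<Longrightarrow> \<exists>M\<in>?S. norm (m - M) < e"
      by (rule directed_matrix_sup[OF _ _ bound]) blast+
    then show ?thesis by blast
  qed
  then obtain m where upper: "\<And>f x. f \<in> F \<Longrightarrow> positive_matrix (m x - f x)"
    and approx: "\<And>x e. 0 < e \<Longrightarrow> \<exists>f\<in>F. norm (m x - f x) < e" by metis
  have "norm (m x) \<le> real CARD('n) * real CARD('n) + 1" for x
  proof -
    obtain f where f: "f \<in> F" "norm (m x - f x) < 1" using approx[of 1] by auto
    then show ?thesis
      using norm_positive_contraction_le[OF pos[OF f(1), of x] le1[OF f(1), of x]]
        norm_triangle_sub[of "m x" "f x"] by simp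
  qed
  then have bddm: "bounded (range m)" by (auto simp: bounded_iff)
  have "F \<noteq> {}" using D(2) DF by blast
  have "is_op_sup D (mult_op m)"
    unfolding DF by (rule is_op_sup_mult_op; fact)
  with sup have pm: "p = mult_op m" by (rule is_op_sup_unique)
  then have m: "m x \<in> projection_matrices" for x using proj projection_mult_op[OF bddm] by simp
  have "((\<lambda>y. (mat 1 - m y) ** m x) \<longlongrightarrow> 0) (nhds x)" for x
  proof -
    have "bounded (range (\<lambda>y. mat 1 - m y))"
      by (intro bounded_projection_valued projection_complement m)
    then obtain K where K: "0 < K" "\<And>y. norm (mat 1 - m y) \<le> K" by (auto simp: bounded_pos)
    show ?thesis
    proof (rule tendstoI)
      fix e :: real assume e: "0 < e"
      obtain f where f: "f \<in> F" "norm (m x - f x) < e / (2 * K)"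
        using approx[of "e / (2 * K)" x] e K by auto
      have "(f \<longlongrightarrow> f x) (nhds x)"
        using cont[OF f(1)] by (simp add: continuous_on_def flip: tendsto_at_iff_tendsto_nhds)
      from tendstoD[OF this, of "e / (2 * K)"] have "\<forall>\<^sub>F y in nhds x. norm (f x - f y) < e / (2 * K)"
        using e K by (simp add: dist_norm norm_minus_commute)
      then show "\<forall>\<^sub>F y in nhds x. dist ((mat 1 - m y) ** m x) 0 < e"
      proof eventually_elim
        case (elim y)
        have "m y ** f y = f y" by (rule positive_below_projection[OF m pos upper]) (fact f(1))+
        then have "(mat 1 - m y) ** m x = (mat 1 - m y) ** (m x - f y)"
          by (simp add: matrix_mult.diff_left matrix_mult.diff_right)
        then have "norm ((mat 1 - m y) ** m x) \<le> norm (mat 1 - m y) * norm (m x - f y)"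
          using norm_matrix_mult_le by metis
        also have "\<dots> \<le> K * norm (m x - f y)" by (intro mult_right_mono K) simp
        also have "\<dots> < K * (e / K)"
        proof (rule mult_strict_left_mono)
          have "norm (m x - f y) \<le> norm (m x - f x) + norm (f x - f y)"
            using norm_triangle_ineq[of "m x - f x" "f x - f y"] by simp
          also have "\<dots> < e / (2 * K) + e / (2 * K)" using f(2) elim by simp
          also have "\<dots> = e / K" using K by simp
          finally show "norm (m x - f y) < e / K" .
        qed (rule K)
        finally show ?case using K by simp
      qed
    qed
  qed
  then have "m \<in> lsc_projections" using m by (simp add: lsc_projections_iff)
  then show ?thesis using pm by blast
qed

text \<open>The net consists of the \<open>a (1 + a)\<^sup>-\<^sup>1\<close> with \<open>a\<close> positive, continuous and bounded and \<open>p a = a\<close>.  Such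
  \<open>a\<close> are closed under addition, which makes the net directed.  If \<open>b\<close> is a continuous section of the
  ranges of \<open>p\<close> with \<open>b x = p x\<close>, then \<open>a = c b b\<^sup>*\<close> gives the value \<open>c / (1 + c) p x\<close> at \<open>x\<close>.\<close>

lemma lsc_imp_open_projection:
  fixes p :: "'x::topological_space \<Rightarrow> complex^'n^'n"
  assumes normal: "normal_space (euclidean :: 'x topology)"
    and regular: "regular_space (euclidean :: 'x topology)"
    and p: "p \<in> lsc_projections"
  shows "mult_op p \<in> open_projections (mult_op ` bcontfun)"
proof -
  have proj: "p x \<in> projection_matrices" for x using p by (simp add: lsc_projections_iff)
  have bddp: "bounded (range p)" using bounded_projection_valued proj by blast
  define B where "B = {a \<in> bcontfun. (\<forall>x. positive_matrix (a x)) \<and> (\<forall>x. p x ** a x = a x)}"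
  define F where "F = (\<lambda>a x. shrink (a x)) ` B"
  have posB: "positive_matrix (a x)" if "a \<in> B" for a x using that by (simp add: B_def)
  have F_bcont: "F \<subseteq> bcontfun" unfolding F_def B_def using shrink_bcontfun by blast
  then have bdd: "bounded (range f)" if "f \<in> F" for f using that by (auto simp: bcontfun_def)
  have pos: "positive_matrix (f x)" and le1: "positive_matrix (mat 1 - f x)" if "f \<in> F" for f x
    using that posB positive_shrink positive_one_minus_shrink by (auto simp: F_def)
  have upper: "positive_matrix (p x - f x)" if "f \<in> F" for f x
  proof (rule projection_dominates[OF proj pos[OF that] le1[OF that]])
    show "p x ** f x = f x" using that shrink_range by (auto simp: F_def B_def)
  qed
  have addB: "(\<lambda>x. a x + b x) \<in> B" if "a \<in> B" "b \<in> B" for a b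
    using that by (auto simp: B_def bcontfun_def positive_matrix_add matrix_mult.add_right
        intro: continuous_on_add bounded_plus_comp)
  have directed: "\<exists>h\<in>F. \<forall>x. positive_matrix (h x - f x) \<and> positive_matrix (h x - g x)"
    if f: "f \<in> F" and g: "g \<in> F" for f g
  proof -
    obtain a where a: "a \<in> B" "f = (\<lambda>x. shrink (a x))" using f unfolding F_def by blast
    obtain b where b: "b \<in> B" "g = (\<lambda>x. shrink (b x))" using g unfolding F_def by blast
    have "positive_matrix (shrink (a x + b x) - f x) \<and> positive_matrix (shrink (a x + b x) - g x)" for x
      unfolding a(2) b(2) using posB[OF a(1), of x] posB[OF b(1), of x]
      by (intro conjI shrink_mono) simp_all
    moreover have "(\<lambda>x. shrink (a x + b x)) \<in> F"
      unfolding F_def by (rule image_eqI[OF refl addB[OF a(1) b(1)]])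
    ultimately show ?thesis by (intro bexI[of _ "\<lambda>x. shrink (a x + b x)"] allI)
  qed
  have approx: "\<exists>f\<in>F. norm (p x - f x) < e" if e: "0 < e" for x e
  proof -
    obtain b where b: "b \<in> bcontfun" "\<And>y. p y ** b y = b y" "b x = p x"
      using lsc_continuous_section[OF normal regular p] by metis
    define c where "c = norm (p x) / e"
    have c: "0 \<le> c" using e by (simp add: c_def)
    define a where "a y = c *\<^sub>R (b y ** ctranspose (b y))" for y
    have ct: "bounded_linear (ctranspose :: complex^'n^'n \<Rightarrow> _)"
      by (rule bounded_linear_intro[of _ 1]) (simp_all add: ctranspose_algebra norm_ctranspose)
    have "continuous_on UNIV a"
      unfolding a_def using b(1)
      by (intro continuous_on_scaleR continuous_on_const matrix_mult.continuous_on
          bounded_linear.continuous_on[OF ct]) (simp_all add: bcontfun_def)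
    moreover have "bounded (range a)"
    proof -
      have "bounded (range b)" using b(1) by (simp add: bcontfun_def)
      moreover then have "bounded (range (\<lambda>y. ctranspose (b y)))"
        by (simp add: bounded_iff norm_ctranspose)
      ultimately show ?thesis
        unfolding a_def by (intro bounded_scaleR_comp bounded_matrix_product)
    qed
    moreover have "positive_matrix (a y)" for y
      unfolding a_def by (intro positive_matrix_scaleR c positive_matrix_mult_ctranspose)
    moreover have "p y ** a y = a y" for y
      by (simp add: a_def matrix_mult.scaleR_right matrix_mul_assoc b(2))
    ultimately have "a \<in> B" by (simp add: B_def bcontfun_def)
    moreover have "norm (p x - shrink (a x)) < e"
    proof -
      have "a x = c *\<^sub>R p x" using proj[of x] by (simp add: a_def b(3) projection_matrices_def)
      then have "p x - shrink (a x) = (1 - c / (1 + c)) *\<^sub>R p x"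
        by (simp add: shrink_scaled_projection[OF proj c] scaleR_diff_left)
      also have "1 - c / (1 + c) = 1 / (1 + c)" using c by (simp add: field_simps)
      finally have "norm (p x - shrink (a x)) = norm (p x) / (1 + c)" using c by simp
      also have "\<dots> < e"
      proof -
        have "norm (p x) = e * c" using e by (simp add: c_def)
        then show ?thesis using e c by (simp add: divide_less_eq algebra_simps)
      qed
      finally show ?thesis .
    qed
    ultimately show ?thesis by (auto simp: F_def)
  qed
  have ne: "F \<noteq> {}" using approx[of 1] by auto
  have "is_op_sup (mult_op ` F) (mult_op p)"
    by (rule is_op_sup_mult_op; fact)
  moreover have "positive_op (mult_op f) \<and> norm (mult_op f) \<le> 1" if "f \<in> F" for f
    using positive_mult_op[OF bdd[OF that]] pos[OF that]
      norm_mult_op_le_1[OF bdd[OF that] positive_contraction_norm_le[OF pos[OF that] le1[OF that]]]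
    by simp
  moreover have "\<exists>h\<in>F. op_le (mult_op f) (mult_op h) \<and> op_le (mult_op g) (mult_op h)"
    if "f \<in> F" "g \<in> F" for f g
    using directed[OF that] op_le_mult_op[OF bdd bdd] that by meson
  moreover have "projection_op (mult_op p)" using projection_mult_op[OF bddp] proj by simp
  ultimately show ?thesis
    unfolding open_projections_iff using F_bcont ne
    by (intro conjI exI[of _ "mult_op ` F"]) auto
qed

lemma lsc_image_eq_open_projections:
  assumes "normal_space (euclidean :: 'x::topological_space topology)"
    and "regular_space (euclidean :: 'x topology)"
  shows "mult_op ` (lsc_projections :: ('x \<Rightarrow> complex^'n^'n) set) = open_projections (mult_op ` bcontfun)"
  using lsc_imp_open_projection[OF assms] open_projection_imp_lsc by blast

lemma mult_op_complement:
  assumes "\<And>x. q x \<in> projection_matrices"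
  shows "mult_op (\<lambda>x. mat 1 - q x) = id_blinfun - mult_op q"
  unfolding mult_op_one[symmetric] by (rule mult_op_diff) (use assms bounded_projection_valued in auto)

theorem proposition3p74:
  assumes "normal_space (euclidean :: 'x::topological_space topology)"
    and "regular_space (euclidean :: 'x topology)"
  shows "mult_op ` (lsc_projections :: ('x \<Rightarrow> complex^'n^'n) set)
           = open_projections (mult_op ` (bcontfun :: ('x \<Rightarrow> complex^'n^'n) set)) \<and>
         mult_op ` (usc_projections :: ('x \<Rightarrow> complex^'n^'n) set)
           = closed_projections (mult_op ` (bcontfun :: ('x \<Rightarrow> complex^'n^'n) set))"
proof
  show lsc: "mult_op ` (lsc_projections :: ('x \<Rightarrow> complex^'n^'n) set)
      = open_projections (mult_op ` (bcontfun :: ('x \<Rightarrow> complex^'n^'n) set))"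
    by (rule lsc_image_eq_open_projections[OF assms])
  have usc: "q \<in> usc_projections \<longleftrightarrow> (\<lambda>x. mat 1 - q x) \<in> lsc_projections"
    for q :: "'x \<Rightarrow> complex^'n^'n"
  proof -
    have "q x \<in> projection_matrices \<longleftrightarrow> mat 1 - q x \<in> projection_matrices" for x
      using projection_complement[of "q x"] projection_complement[of "mat 1 - q x"] by auto
    then show ?thesis
      by (auto simp: usc_projections_def lsc_projections_def upper_semicontinuous_def image_subset_iff)
  qed
  show "mult_op ` (usc_projections :: ('x \<Rightarrow> complex^'n^'n) set)
      = closed_projections (mult_op ` (bcontfun :: ('x \<Rightarrow> complex^'n^'n) set))"
  proof (intro equalityI subsetI)
    fix p assume "p \<in> mult_op ` (usc_projections :: ('x \<Rightarrow> complex^'n^'n) set)"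
    then obtain q :: "'x \<Rightarrow> complex^'n^'n" where q: "q \<in> usc_projections" "p = mult_op q" by blast
    have proj: "q x \<in> projection_matrices" for x using q(1) by (auto simp: usc_projections_def)
    have "projection_op p"
      unfolding q(2) using projection_mult_op bounded_projection_valued proj by blast
    moreover have "id_blinfun - p \<in> open_projections (mult_op ` bcontfun)"
      using q usc lsc mult_op_complement[of q, OF proj] by (metis imageI)
    ultimately show "p \<in> closed_projections (mult_op ` bcontfun)"
      by (simp add: closed_projections_def)
  next
    fix p :: "('x, 'n) l2_sum \<Rightarrow>\<^sub>L ('x, 'n) l2_sum"
    assume "p \<in> closed_projections (mult_op ` bcontfun)"
    then obtain r :: "'x \<Rightarrow> complex^'n^'n" where r: "r \<in> lsc_projections" "id_blinfun - p = mult_op r"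
      unfolding closed_projections_def lsc[symmetric] by blast
    have "r x \<in> projection_matrices" for x using r(1) by (simp add: lsc_projections_iff)
    from mult_op_complement[of r, OF this] have "p = mult_op (\<lambda>x. mat 1 - r x)"
      by (simp flip: r(2))
    moreover have "(\<lambda>x. mat 1 - r x) \<in> usc_projections" using r(1) by (simp add: usc)
    ultimately show "p \<in> mult_op ` usc_projections" by blast
  qed
qed

end
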